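(* Let $1<p<\infty$, let $(X,d,\mu)$ be a Cheeger space for the exponent $p$, and let $\Gamma_p$ be the $\overline\Gamma$-limit of the localized functionals $E_{p,r_n}(\cdot,\cdot)$ along a sequence $r_n\to0^+$ for which it exists. For any $f\in KS^{1,p}(X)$, the $p$-energy measure $\Gamma_p(f)$ is absolutely continuous with respect to $\mu$.
   Context: Cheeger space (for $1\le p<\infty$): a locally compact, complete metric space $(X,d)$ with a Radon measure $\mu$ such that, writing $B(x,r)=\{y:d(x,y)<r\}$: (VD) there is $C>0$ with $0<\mu(B(x,2r))\le C\mu(B(x,r))<\infty$ for all $x\in X$, $r>0$; (PI) there are $C>0$, $\lambda\ge1$ such that for every Lipschitz $f$ on $X$ and every ball $B(x,R)$, $\int_{B(x,R)}|f-f_{B(x,R)}|^p d\mu\le CR^p\int_{B(x,\lambda R)}(\mathrm{Lip} f)^p d\mu$, where $f_B=\frac1{\mu(B)}\int_B f\,d\mu$ and $(\mathrm{Lip} f)(y)=\limsup_{r\to0^+}\sup_{d(x,y)\le r}\frac{|f(x)-f(y)|}{r}$. Energies: for $r>0$, $f\in L^p(X,\mu)$ and $U\subset X$ open, $E_{p,r}(f,U)=\frac1{r^p}\int_U\frac1{\mu(B(x,r))}\int_{B(x,r)}|f(y)-f(x)|^p d\mu(y)d\mu(x)$. The Korevaar-Schoen space is $KS^{1,p}(X)=\{f\in L^p(X,\mu):\limsup_{r\to0^+}E_{p,r}(f,X)<\infty\}$. $U\Subset V$ means $\overline U$ is compact and $\overline U\subset V$; $\mathcal{O}$ is the family of open subsets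 of $X$. $\overline{\Gamma}$-convergence: $E_n\colon L^p(X,\mu)\times\mathcal{O}\to[-\infty,\infty]$ $\overline\Gamma$-converge to $E$ if (i) $E(f,U)\le\liminf_nE_n(f_n,U)$ for all $U\in\mathcal{O}$ whenever $f_n\to f$ strongly in $L^p$; (ii) for all $f$ and all $U\Subset V$ in $\mathcal{O}$ there is $f_n\to f$ in $L^p$ with $\limsup_nE_n(f_n,U)\le E(f,V)$; and $E$ is inner regular: $E(f,V)=\sup\{E(f,U):U\in\mathcal{O},U\Subset V\}$. Notation: $\Gamma_p(f)(U)=\Gamma_p(f,U)$. For $f\in KS^{1,p}(X)$, the set function $\Gamma_p(f)$ on open sets is the restriction of a finite Radon measure on $X$, called the $p$-energy measure of $f$ and also denoted $\Gamma_p(f)$. (The sequence $r_n$ is also taken so that $E_{p,r_n}(\cdot,X)$ $\Gamma$-converges in $L^p(X,\mu)$.) *)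

theory Defs
  imports "HOL-Analysis.Analysis"
begin

definition radon_measure :: "'a::metric_space measure \<Rightarrow> bool" where
  "radon_measure M \<longleftrightarrow> sets M = sets borel
     \<and> (\<forall>K. compact K \<longrightarrow> emeasure M K < \<infinity>)
     \<and> (\<forall>A\<in>sets borel. emeasure M A = (INF U\<in>{U. open U \<and> A \<subseteq> U}. emeasure M U))
     \<and> (\<forall>U. open U \<longrightarrow> emeasure M U = (SUP K\<in>{K. compact K \<and> K \<subseteq> U}. emeasure M K))"

(* The pointwise Lipschitz constant.  It is ennreal-valued so that the upper limit exists for
   every f; it is bounded by L whenever f is L-Lipschitz. *)
definition Lip :: "('a::metric_space \<Rightarrow> real) \<Rightarrow> 'a \<Rightarrow> ennreal" where
  "Lip f y = Limsup (at_right 0) (\<lambda>r. SUP x\<in>cball y r. ennreal (\<bar>f x - f y\<bar> / r))"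

definition volume_doubling :: "'a::metric_space measure \<Rightarrow> bool" where
  "volume_doubling \<mu> \<longleftrightarrow> (\<exists>C>0. \<forall>x. \<forall>r>0.
     0 < emeasure \<mu> (ball x (2 * r))
     \<and> emeasure \<mu> (ball x (2 * r)) \<le> ennreal C * emeasure \<mu> (ball x r)
     \<and> ennreal C * emeasure \<mu> (ball x r) < \<infinity>)"

definition ball_average :: "'a::metric_space measure \<Rightarrow> 'a set \<Rightarrow> ('a \<Rightarrow> real) \<Rightarrow> real" where
  "ball_average \<mu> B f = (LINT y:B|\<mu>. f y) / measure \<mu> B"

(* enn2real is harmless here: Lip f is finite because f is Lipschitz. *)
definition poincare_inequality :: "real \<Rightarrow> 'a::metric_space measure \<Rightarrow> bool" where
  "poincare_inequality p \<mu> \<longleftrightarrow> (\<exists>C>0. \<exists>\<Lambda>\<ge>1. \<forall>f. (\<exists>L. L-lipschitz_on UNIV f) \<longrightarrow>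
     (\<forall>x. \<forall>R>0.
        (\<integral>\<^sup>+y\<in>ball x R. ennreal (\<bar>f y - ball_average \<mu> (ball x R) f\<bar> powr p) \<partial>\<mu>)
        \<le> ennreal (C * R powr p)
          * (\<integral>\<^sup>+y\<in>ball x (\<Lambda> * R). ennreal (enn2real (Lip f y) powr p) \<partial>\<mu>)))"

(* Completeness of the metric is part of the sort. *)
definition cheeger_space :: "real \<Rightarrow> 'a::complete_space measure \<Rightarrow> bool" where
  "cheeger_space p \<mu> \<longleftrightarrow> locally_compact_space (euclidean :: 'a topology)
     \<and> radon_measure \<mu> \<and> volume_doubling \<mu> \<and> poincare_inequality p \<mu>"

(* Elements of L^p are represented by functions; functionals subject to the Gamma-convergence
   notions below automatically agree on almost everywhere equal representatives. *)
definition Lp :: "real \<Rightarrow> 'a measure \<Rightarrow> ('a \<Rightarrow> real) set" where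
  "Lp p \<mu> = {f \<in> borel_measurable \<mu>. integrable \<mu> (\<lambda>x. \<bar>f x\<bar> powr p)}"

definition Lp_norm :: "real \<Rightarrow> 'a measure \<Rightarrow> ('a \<Rightarrow> real) \<Rightarrow> real" where
  "Lp_norm p \<mu> f = (LINT x|\<mu>. \<bar>f x\<bar> powr p) powr (1 / p)"

definition Lp_converges ::
    "real \<Rightarrow> 'a measure \<Rightarrow> (nat \<Rightarrow> 'a \<Rightarrow> real) \<Rightarrow> ('a \<Rightarrow> real) \<Rightarrow> bool" where
  "Lp_converges p \<mu> fs f \<longleftrightarrow> (\<forall>n. fs n \<in> Lp p \<mu>) \<and> f \<in> Lp p \<mu>
     \<and> (\<lambda>n. Lp_norm p \<mu> (\<lambda>x. fs n x - f x)) \<longlonglongrightarrow> 0"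

definition energy ::
    "real \<Rightarrow> 'a::metric_space measure \<Rightarrow> real \<Rightarrow> ('a \<Rightarrow> real) \<Rightarrow> 'a set \<Rightarrow> ennreal" where
  "energy p \<mu> r f U = ennreal (1 / r powr p) *
     (\<integral>\<^sup>+x\<in>U. (1 / emeasure \<mu> (ball x r)) *
        (\<integral>\<^sup>+y\<in>ball x r. ennreal (\<bar>f y - f x\<bar> powr p) \<partial>\<mu>) \<partial>\<mu>)"

definition KS :: "real \<Rightarrow> 'a::metric_space measure \<Rightarrow> ('a \<Rightarrow> real) set" where
  "KS p \<mu> = {f \<in> Lp p \<mu>. Limsup (at_right 0) (\<lambda>r. energy p \<mu> r f UNIV) < \<infinity>}"

definition compactly_contained :: "'a::metric_space set \<Rightarrow> 'a set \<Rightarrow> bool" where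
  "compactly_contained U V \<longleftrightarrow> compact (closure U) \<and> closure U \<subseteq> V"

definition Gamma_converges ::
    "real \<Rightarrow> 'a measure \<Rightarrow> (nat \<Rightarrow> ('a \<Rightarrow> real) \<Rightarrow> ereal) \<Rightarrow> (('a \<Rightarrow> real) \<Rightarrow> ereal) \<Rightarrow> bool" where
  "Gamma_converges p \<mu> En E \<longleftrightarrow>
     (\<forall>fs f. Lp_converges p \<mu> fs f \<longrightarrow> E f \<le> liminf (\<lambda>n. En n (fs n)))
     \<and> (\<forall>f\<in>Lp p \<mu>. \<exists>fs. Lp_converges p \<mu> fs f \<and> limsup (\<lambda>n. En n (fs n)) \<le> E f)"

definition inner_regular ::
    "real \<Rightarrow> 'a::metric_space measure \<Rightarrow> (('a \<Rightarrow> real) \<Rightarrow> 'a set \<Rightarrow> ereal) \<Rightarrow> bool" where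
  "inner_regular p \<mu> E \<longleftrightarrow> (\<forall>f\<in>Lp p \<mu>. \<forall>V. open V \<longrightarrow>
     E f V = (SUP U\<in>{U. open U \<and> compactly_contained U V}. E f U))"

definition Gamma_bar_converges ::
    "real \<Rightarrow> 'a::metric_space measure \<Rightarrow> (nat \<Rightarrow> ('a \<Rightarrow> real) \<Rightarrow> 'a set \<Rightarrow> ereal)
      \<Rightarrow> (('a \<Rightarrow> real) \<Rightarrow> 'a set \<Rightarrow> ereal) \<Rightarrow> bool" where
  "Gamma_bar_converges p \<mu> En E \<longleftrightarrow>
     (\<forall>fs f. Lp_converges p \<mu> fs f \<longrightarrow>
        (\<forall>U. open U \<longrightarrow> E f U \<le> liminf (\<lambda>n. En n (fs n) U)))
     \<and> (\<forall>f\<in>Lp p \<mu>. \<forall>U V. open U \<longrightarrow> open V \<longrightarrow> compactly_contained U V \<longrightarrow>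
        (\<exists>fs. Lp_converges p \<mu> fs f \<and> limsup (\<lambda>n. En n (fs n) U) \<le> E f V))
     \<and> inner_regular p \<mu> E"

(* Outer regularity makes \<nu> unique for given \<Gamma> and f. *)
definition is_energy_measure ::
    "(('a::metric_space \<Rightarrow> real) \<Rightarrow> 'a set \<Rightarrow> ereal) \<Rightarrow> ('a \<Rightarrow> real) \<Rightarrow> 'a measure \<Rightarrow> bool" where
  "is_energy_measure \<Gamma> f \<nu> \<longleftrightarrow> radon_measure \<nu> \<and> finite_measure \<nu>
     \<and> (\<forall>U. open U \<longrightarrow> enn2ereal (emeasure \<nu> U) = \<Gamma> f U)"

end

theory Submission
  imports Defs
begin

text \<open>
  Mollifying \<open>f\<close> at scale \<open>\<epsilon>\<close> with a normalised bump function gives \<open>h\<close> with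
  \<open>\<bar>h z - h x\<bar> \<le> G x * dist x z\<close> at small scales, where, by doubling, \<open>G x\<close> is a constant times
  \<open>\<epsilon>\<^sup>-\<^sup>1\<close> times the \<open>L\<^sup>p\<close> mean of \<open>f - f x\<close> over \<open>ball x (2 * \<epsilon>)\<close>; so \<open>\<integral> G\<^sup>p\<close> is bounded by the energy
  of \<open>f\<close> at scale \<open>2 * \<epsilon>\<close>. The pairs \<open>(h, G)\<close> with \<open>h\<close> close to \<open>f\<close> form a convex set, and strict
  convexity of \<open>t\<^sup>p\<close> makes the \<open>G\<^sup>p\<close> of a sequence of near minimisers of \<open>\<integral> G\<^sup>p\<close> uniformly integrable.
  The energy of \<open>h\<close> on \<open>U\<close> is at most \<open>\<integral>\<^sub>U G\<^sup>p\<close> at small scales, so the liminf inequality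
  along a diagonal sequence \<open>h \<rightarrow> f\<close> makes \<open>\<Gamma> f U\<close> small whenever \<open>\<integral>\<^sub>U G\<^sup>p\<close> is small for one fixed \<open>G\<close>
  in the tail of that sequence.
\<close>

subsection \<open>Convexity of powers and measures of balls\<close>

lemma powr_add_le:
  fixes a b p :: real
  assumes "0 \<le> a" "0 \<le> b" "0 \<le> p"
  shows "(a + b) powr p \<le> 2 powr p * (a powr p + b powr p)"
proof -
  have "(a + b) powr p \<le> (2 * max a b) powr p"
    using assms by (intro powr_mono2) auto
  also have "\<dots> = 2 powr p * (max a b) powr p"
    using assms by (simp add: powr_mult)
  also have "(max a b) powr p \<le> a powr p + b powr p"
    by (auto simp: max_def)
  finally show ?thesis by simp
qed

lemma powr_midpoint_le:
  fixes a b p :: real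
  assumes "0 \<le> a" "0 \<le> b" "1 \<le> p"
  shows "((a + b) / 2) powr p \<le> (a powr p + b powr p) / 2"
proof -
  have half: "(1 / 2) powr p \<le> (1 / 2 :: real)"
    using powr_mono'[of 1 p "1/2::real"] assms by simp
  \<comment> \<open>Convexity of \<open>t powr p\<close> is taken on the open half line; a zero
    argument is covered by \<open>half\<close> instead.\<close>
  consider "a = 0" | "b = 0" | "0 < a" "0 < b"
    using assms by linarith
  then show ?thesis
  proof cases
    case 1
    then show ?thesis
      using half mult_right_mono[OF half, of "b powr p"] assms by (simp add: powr_divide)
  next
    case 2
    then show ?thesis
      using half mult_right_mono[OF half, of "a powr p"] assms by (simp add: powr_divide)
  next
    case 3
    have "convex_on {0<..} (\<lambda>x::real. x powr p)"
      using powr_convex assms by blast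
    from convex_onD[OF this, of "1/2" a b] 3 show ?thesis
      by (simp add: add_divide_distrib)
  qed
qed

text \<open>The midpoint Jensen gap of \<open>t powr p\<close>, nonnegative on nonnegative arguments
  when \<open>1 \<le> p\<close>. Its integral is small for two near minimisers because their
  midpoint is again a competitor.\<close>

definition powr_defect :: "real \<Rightarrow> real \<Rightarrow> real \<Rightarrow> real" where
  "powr_defect p a b = (a powr p + b powr p) / 2 - ((a + b) / 2) powr p"

text \<open>The substitute for uniform convexity of \<open>L\<^sup>p\<close>: either \<open>a\<close> is comparable to \<open>b\<close>, or the
  convexity defect is comparable to \<open>a powr p\<close>.\<close>

lemma powr_le_defect:
  fixes p :: real
  assumes "1 < p"
  obtains K :: real where "0 < K"
    "\<And>a b. 0 \<le> a \<Longrightarrow> 0 \<le> b \<Longrightarrow> a powr p \<le> K * (b powr p + powr_defect p a b)"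
proof -
  \<comment> \<open>The threshold \<open>s > 1\<close> satisfies \<open>s powr p = 2 powr q\<close>,
    so \<open>(s / 2) powr p = 2 powr (- q) / 2\<close> is still below \<open>1 / 2\<close>, and
    \<open>c\<close> is the difference.\<close>
  define q where "q = (p - 1) / 2"
  define s where "s = 2 powr (q / p)"
  define c where "c = (1 - 2 powr (- q)) / 2"
  have q: "0 < q" using assms by (simp add: q_def)
  have s: "1 < s" using q assms unfolding s_def by simp
  have "2 powr (- q) < (1::real)"
    using q powr_less_mono[of "-q" 0 "2::real"] by simp
  then have c: "0 < c" by (simp add: c_def)
  define K where "K = (1 / (s - 1)) powr p + 1 / c"
  have K0: "0 < K" using c s unfolding K_def by (simp add: add_nonneg_pos)
  have "a powr p \<le> K * (b powr p + powr_defect p a b)" if ab: "0 \<le> a" "0 \<le> b" for a b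
  proof -
    have D: "0 \<le> powr_defect p a b"
      using powr_midpoint_le[OF ab] assms by (simp add: powr_defect_def)
    \<comment> \<open>If \<open>b\<close> is small against \<open>a\<close>, the midpoint is at most
      \<open>s * a / 2\<close>, which leaves a defect of at least \<open>c * a powr p\<close>;
      otherwise \<open>a\<close> is at most a multiple of \<open>b\<close>. The two summands of
      \<open>K\<close> serve these two cases.\<close>
    show ?thesis
    proof (cases "b \<le> (s - 1) * a")
      case True
      have "((a + b) / 2) powr p \<le> (s * a / 2) powr p"
        using True ab assms by (intro powr_mono2) (auto simp: algebra_simps)
      also have "\<dots> = s powr p / 2 powr p * a powr p"
        using ab s by (simp add: powr_mult powr_divide)
      also have "s powr p / 2 powr p = 2 powr (- q) / 2"
      proof -
        have "s powr p / 2 powr p = 2 powr (q - p)"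
          using assms by (simp add: s_def powr_powr powr_diff)
        also have "q - p = - q - 1" by (simp add: q_def field_simps)
        finally show ?thesis by (simp add: powr_diff)
      qed
      finally have "((a + b) / 2) powr p \<le> 2 powr (- q) / 2 * a powr p" .
      moreover have "c * a powr p = a powr p / 2 - 2 powr (- q) / 2 * a powr p"
        by (simp add: c_def algebra_simps diff_divide_distrib)
      ultimately have "c * a powr p \<le> powr_defect p a b"
        unfolding powr_defect_def add_divide_distrib using powr_ge_zero[of b p] by linarith
      then have "a powr p \<le> 1 / c * powr_defect p a b"
        using c by (simp add: field_simps)
      also have "\<dots> \<le> K * (b powr p + powr_defect p a b)"
        using D c K0 by (intro mult_mono) (auto simp: K_def)
      finally show ?thesis .
    next
      case False
      then have "a \<le> 1 / (s - 1) * b" using s by (simp add: field_simps)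
      then have "a powr p \<le> (1 / (s - 1) * b) powr p"
        using ab assms by (intro powr_mono2) auto
      also have "\<dots> = (1 / (s - 1)) powr p * b powr p"
        using s ab by (simp add: powr_mult powr_divide)
      also have "\<dots> \<le> K * (b powr p + powr_defect p a b)"
        using D c K0 by (intro mult_mono) (auto simp: K_def)
      finally show ?thesis .
    qed
  qed
  with K0 that show ?thesis by blast
qed

text \<open>The function is lower semicontinuous: by continuity from below a slightly smaller
  concentric ball already has measure above \<open>a\<close>, and every ball of radius
  \<open>R\<close> with centre close to \<open>x\<close> contains it.\<close>

lemma emeasure_ball_measurable:
  fixes M :: "'a::metric_space measure"
  assumes sets: "sets M = sets borel"
  shows "(\<lambda>x. emeasure M (ball x R)) \<in> borel_measurable borel"
proof (rule borel_measurableI_greater)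
  fix a :: ennreal
  have "open {x. a < emeasure M (ball x R)}"
    unfolding open_dist
  proof
    fix x assume "x \<in> {x. a < emeasure M (ball x R)}"
    then have a: "a < emeasure M (ball x R)" by simp
    define B where "B n = ball x (R - 1 / real (Suc n))" for n
    have inc: "incseq B"
      unfolding incseq_def B_def by (auto intro!: subset_ball simp: frac_le)
    have UN: "(\<Union>n. B n) = ball x R"
    proof (safe)
      fix y assume "y \<in> ball x R"
      then have "0 < R - dist x y" by simp
      then obtain n where "inverse (real (Suc n)) < R - dist x y"
        using reals_Archimedean by blast
      then have "y \<in> B n" by (simp add: B_def inverse_eq_divide)
      then show "y \<in> (\<Union>n. B n)" by blast
    next
      fix y n assume "y \<in> B n"
      then have "dist x y < R - 1 / real (Suc n)" by (simp add: B_def)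
      also have "\<dots> \<le> R" by simp
      finally show "y \<in> ball x R" by simp
    qed
    have "range B \<subseteq> sets M"
      unfolding B_def using sets by (metis borel_open image_subsetI open_ball)
    from Lim_emeasure_incseq[OF this inc]
    have "(\<lambda>n. emeasure M (B n)) \<longlonglongrightarrow> emeasure M (ball x R)"
      unfolding UN .
    from order_tendstoD(1)[OF this a] obtain n where n: "a < emeasure M (B n)"
      by (auto simp: eventually_sequentially)
    show "\<exists>e>0. \<forall>y. dist y x < e \<longrightarrow> y \<in> {x. a < emeasure M (ball x R)}"
    proof (intro exI conjI allI impI)
      show "0 < 1 / real (Suc n)" by simp
      fix y assume y: "dist y x < 1 / real (Suc n)"
      have "B n \<subseteq> ball y R"
      proof
        fix z assume "z \<in> B n"
        then have "dist x z < R - 1 / real (Suc n)" by (simp add: B_def)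
        then show "z \<in> ball y R"
          using y dist_triangle[of y z x] by simp
      qed
      then have "emeasure M (B n) \<le> emeasure M (ball y R)"
        using sets by (intro emeasure_mono) auto
      then show "y \<in> {x. a < emeasure M (ball x R)}" using n by simp
    qed
  qed
  then show "{x \<in> space borel. a < emeasure M (ball x R)} \<in> sets borel"
    by simp
qed

lemma le_one_add_powr:
  fixes t p :: real
  assumes "0 \<le> t" "1 \<le> p"
  shows "t \<le> 1 + t powr p"
proof (cases "t \<le> 1")
  case False
  then have "t powr 1 \<le> t powr p" using assms by (intro powr_mono) auto
  then show ?thesis using False by simp
qed (simp add: add_increasing2)

text \<open>Jensen's inequality for the mean value of \<open>u\<close>, up to the factor 2.\<close>

lemma mean_le_powr_mean:
  fixes u :: "'a \<Rightarrow> real" and p :: real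
  assumes "1 < p" and A: "A \<in> sets M" "0 < measure M A" "emeasure M A < \<infinity>"
    and u: "\<And>x. 0 \<le> u x" "set_integrable M A u" "set_integrable M A (\<lambda>x. u x powr p)"
  shows "(LINT x:A|M. u x) / measure M A
    \<le> 2 * ((LINT x:A|M. u x powr p) / measure M A) powr (1 / p)"
proof -
  define J where "J = (LINT x:A|M. u x powr p)"
  define V where "V = measure M A"
  have V: "0 < V" using A by (simp add: V_def)
  have J0: "0 \<le> J" unfolding J_def set_lebesgue_integral_def
    by (intro integral_nonneg_AE) auto
  have cA: "set_integrable M A (\<lambda>x. c)" for c :: real
    unfolding set_integrable_def using A by (intro integrable_scaleR_left) auto
  \<comment> \<open>Integrate the pointwise bound of \<open>u\<close> by \<open>s\<close> plus
    \<open>s / s powr p\<close> times \<open>u powr p\<close>. If \<open>s powr p\<close> dominates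
    the mean of \<open>u powr p\<close>, each term contributes at most \<open>s\<close> to the mean;
    the optimal \<open>s\<close> is inserted below.\<close>
  have *: "(LINT x:A|M. u x) / V \<le> 2 * s" if s: "0 < s" "J / V \<le> s powr p" for s
  proof -
    have pw: "u x \<le> s + s / s powr p * u x powr p" for x
    proof (cases "u x \<le> s")
      case False
      then have "(u x / s) powr 1 \<le> (u x / s) powr p"
        using s assms(1) by (intro powr_mono) auto
      then have "u x / s \<le> u x powr p / s powr p"
        using u(1)[of x] s by (simp add: powr_divide)
      then have "u x \<le> s / s powr p * u x powr p" using s by (simp add: field_simps)
      then show ?thesis using s by simp
    qed (use s in \<open>simp add: add_increasing2\<close>)
    have "(LINT x:A|M. u x) \<le> (LINT x:A|M. s + s / s powr p * u x powr p)"
      using pw by (intro set_integral_mono u set_integral_add cA set_integrable_mult_right) auto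
    also have "\<dots> = (LINT x:A|M. s) + s / s powr p * J"
      unfolding J_def by (subst set_integral_add(2)) (auto intro!: cA u set_integrable_mult_right)
    also have "(LINT x:A|M. s) = V * s"
      using A by (simp add: set_lebesgue_integral_def V_def)
    also have "s / s powr p * J \<le> s / s powr p * (V * s powr p)"
      using s V by (intro mult_left_mono) (auto simp: field_simps)
    also have "\<dots> = V * s" using s by simp
    finally show ?thesis using V by (simp add: field_simps)
  qed
  show ?thesis
  proof (cases "J = 0")
    case False
    then have "0 < J / V" using J0 V by simp
    then have "((J / V) powr (1 / p)) powr p = J / V"
      using assms(1) by (simp add: powr_powr del: abs_divide)
    with *[of "(J / V) powr (1 / p)"] False V show ?thesis
      unfolding J_def[symmetric] V_def[symmetric] by auto
  next
    case True
    \<comment> \<open>The optimal value \<open>s = 0\<close> is excluded in \<open>*\<close>, but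
      here every positive \<open>s\<close> is admissible.\<close>
    have "(LINT x:A|M. u x) / V \<le> 0 + e" if "0 < e" for e
      using *[of "e / 2"] True that by simp
    then have "(LINT x:A|M. u x) / V \<le> 0" by (rule field_le_epsilon)
    then show ?thesis using True by (simp add: J_def V_def)
  qed
qed

subsection \<open>Energy densities\<close>

lemma LpD:
  assumes "f \<in> Lp p \<mu>"
  shows "f \<in> borel_measurable \<mu>" "integrable \<mu> (\<lambda>x. \<bar>f x\<bar> powr p)"
  using assms by (auto simp: Lp_def)

lemma Lp_dominated:
  assumes "f \<in> borel_measurable \<mu>" "g \<in> Lp p \<mu>" "0 \<le> p" "\<And>x. \<bar>f x\<bar> \<le> g x"
  shows "f \<in> Lp p \<mu>"
proof -
  have "integrable \<mu> (\<lambda>x. \<bar>f x\<bar> powr p)"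
  proof (rule Bochner_Integration.integrable_bound[OF LpD(2)[OF assms(2)]])
    show "AE x in \<mu>. norm (\<bar>f x\<bar> powr p) \<le> norm (\<bar>g x\<bar> powr p)"
      using assms(3,4) by (intro AE_I2) (auto intro!: powr_mono2 order_trans[OF assms(4)])
  qed (use assms(1) in measurable)
  then show ?thesis using assms(1) by (simp add: Lp_def)
qed

lemma Lp_abs: "f \<in> Lp p \<mu> \<Longrightarrow> (\<lambda>x. \<bar>f x\<bar>) \<in> Lp p \<mu>"
  by (auto simp: Lp_def)

lemma Lp_add:
  assumes "f \<in> Lp p \<mu>" "g \<in> Lp p \<mu>" "0 \<le> p"
  shows "(\<lambda>x. f x + g x) \<in> Lp p \<mu>"
proof -
  have m: "f \<in> borel_measurable \<mu>" "g \<in> borel_measurable \<mu>" using assms LpD by auto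
  have "integrable \<mu> (\<lambda>x. \<bar>f x + g x\<bar> powr p)"
  proof (rule Bochner_Integration.integrable_bound)
    show "integrable \<mu> (\<lambda>x. 2 powr p * (\<bar>f x\<bar> powr p + \<bar>g x\<bar> powr p))"
      using LpD[OF assms(1)] LpD[OF assms(2)] by auto
    show "AE x in \<mu>. norm (\<bar>f x + g x\<bar> powr p)
        \<le> norm (2 powr p * (\<bar>f x\<bar> powr p + \<bar>g x\<bar> powr p))"
    proof (intro AE_I2)
      fix x
      have "\<bar>f x + g x\<bar> powr p \<le> (\<bar>f x\<bar> + \<bar>g x\<bar>) powr p"
        using assms by (intro powr_mono2) auto
      also have "\<dots> \<le> 2 powr p * (\<bar>f x\<bar> powr p + \<bar>g x\<bar> powr p)"
        using assms by (intro powr_add_le) auto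
      finally show "norm (\<bar>f x + g x\<bar> powr p)
        \<le> norm (2 powr p * (\<bar>f x\<bar> powr p + \<bar>g x\<bar> powr p))" by simp
    qed
  qed (use m in measurable)
  then show ?thesis using m by (simp add: Lp_def)
qed

lemma Lp_cmult:
  assumes "f \<in> Lp p \<mu>"
  shows "(\<lambda>x. c * f x) \<in> Lp p \<mu>"
  using assms by (auto simp: Lp_def abs_mult powr_mult)

lemma Lp_diff:
  assumes "f \<in> Lp p \<mu>" "g \<in> Lp p \<mu>" "0 \<le> p"
  shows "(\<lambda>x. f x - g x) \<in> Lp p \<mu>"
  using Lp_add[OF assms(1) Lp_cmult[OF assms(2), of "-1"] assms(3)] by simp

text \<open>Doubling is phrased with the real-valued \<open>measure\<close>, so that averages over
  balls become quotients of real numbers.\<close>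

locale doubling =
  fixes \<mu> :: "'a::metric_space measure" and C :: real
  assumes sets_eq [measurable_cong, simp]: "sets \<mu> = sets borel"
    and C_pos: "0 < C"
    and emeasure_ball: "0 < s \<Longrightarrow> emeasure \<mu> (ball x s) < \<infinity>"
    and measure_ball: "0 < s \<Longrightarrow> 0 < measure \<mu> (ball x s)"
    and measure_double: "0 < s \<Longrightarrow> measure \<mu> (ball x (2 * s)) \<le> C * measure \<mu> (ball x s)"
begin

lemma space_eq [simp]: "space \<mu> = UNIV"
  using sets_eq_imp_space_eq[OF sets_eq] by simp

text \<open>Constants are integrable on balls, which have finite measure; first powers are then
  dominated through \<open>t \<le> 1 + t powr p\<close>.\<close>

lemma Lp_set_integrable_ball:
  assumes "f \<in> Lp p \<mu>" "1 \<le> p" "0 < s"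
  shows "set_integrable \<mu> (ball x s) (\<lambda>y. \<bar>f y - c\<bar> powr p)"
    and "set_integrable \<mu> (ball x s) (\<lambda>y. f y - c)"
proof -
  have m [measurable]: "f \<in> borel_measurable \<mu>" using assms(1) by (rule LpD)
  have c: "set_integrable \<mu> (ball x s) (\<lambda>y. b)" for b :: real
    using emeasure_ball[OF assms(3)] unfolding set_integrable_def
    by (intro integrable_scaleR_left) simp_all
  have *: "set_integrable \<mu> (ball x s) (\<lambda>y. \<bar>f y\<bar> powr p)"
    using LpD(2)[OF assms(1)] unfolding set_integrable_def
    by (intro integrable_mult_indicator) simp_all
  show 1: "set_integrable \<mu> (ball x s) (\<lambda>y. \<bar>f y - c\<bar> powr p)"
  proof (rule set_integrable_bound)
    show "set_integrable \<mu> (ball x s) (\<lambda>y. 2 powr p * (\<bar>f y\<bar> powr p + \<bar>c\<bar> powr p))"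
      by (intro set_integrable_mult_right set_integral_add * c)
    show "set_borel_measurable \<mu> (ball x s) (\<lambda>y. \<bar>f y - c\<bar> powr p)"
      unfolding set_borel_measurable_def
      by (intro borel_measurable_scaleR borel_measurable_indicator) (simp, measurable)
    show "AE y in \<mu>. y \<in> ball x s \<longrightarrow> norm (\<bar>f y - c\<bar> powr p)
        \<le> norm (2 powr p * (\<bar>f y\<bar> powr p + \<bar>c\<bar> powr p))"
    proof (intro AE_I2 impI)
      fix y
      have "\<bar>f y - c\<bar> powr p \<le> (\<bar>f y\<bar> + \<bar>c\<bar>) powr p"
        using assms by (intro powr_mono2) auto
      also have "\<dots> \<le> 2 powr p * (\<bar>f y\<bar> powr p + \<bar>c\<bar> powr p)"
        using assms by (intro powr_add_le) auto
      finally show "norm (\<bar>f y - c\<bar> powr p)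
        \<le> norm (2 powr p * (\<bar>f y\<bar> powr p + \<bar>c\<bar> powr p))" by simp
    qed
  qed
  show "set_integrable \<mu> (ball x s) (\<lambda>y. f y - c)"
  proof (rule set_integrable_bound)
    show "set_integrable \<mu> (ball x s) (\<lambda>y. 1 + \<bar>f y - c\<bar> powr p)"
      by (intro set_integral_add 1 c)
    show "set_borel_measurable \<mu> (ball x s) (\<lambda>y. f y - c)"
      unfolding set_borel_measurable_def
      by (intro borel_measurable_scaleR borel_measurable_indicator) (simp, measurable)
    show "AE y in \<mu>. y \<in> ball x s \<longrightarrow> norm (f y - c) \<le> norm (1 + \<bar>f y - c\<bar> powr p)"
      using assms(2) le_one_add_powr[of "\<bar>f y - c\<bar>" p for y]
      by (intro AE_I2 impI) (auto simp: add_nonneg_nonneg)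
  qed
qed

text \<open>For \<open>f\<close> in \<open>Lp\<close> and \<open>s > 0\<close> this is the inner
  average of \<open>energy\<close> as a real number.\<close>

definition mean_osc :: "real \<Rightarrow> ('a \<Rightarrow> real) \<Rightarrow> real \<Rightarrow> 'a \<Rightarrow> real" where
  "mean_osc p f s x = (LINT y:ball x s|\<mu>. \<bar>f y - f x\<bar> powr p) / measure \<mu> (ball x s)"

lemma mean_osc_nonneg: "0 \<le> mean_osc p f s x"
  unfolding mean_osc_def set_lebesgue_integral_def
  by (intro divide_nonneg_nonneg integral_nonneg_AE) auto

lemma set_nn_integral_ball:
  assumes "f \<in> Lp p \<mu>" "1 \<le> p" "0 < s"
  shows "(\<integral>\<^sup>+y\<in>ball x s. ennreal (\<bar>f y - c\<bar> powr p) \<partial>\<mu>)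
    = ennreal (LINT y:ball x s|\<mu>. \<bar>f y - c\<bar> powr p)"
proof -
  have "(\<integral>\<^sup>+y\<in>ball x s. ennreal (\<bar>f y - c\<bar> powr p) \<partial>\<mu>)
      = (\<integral>\<^sup>+y. ennreal (indicator (ball x s) y *\<^sub>R (\<bar>f y - c\<bar> powr p)) \<partial>\<mu>)"
    by (intro nn_integral_cong) (auto simp: indicator_def)
  then show ?thesis
    using Lp_set_integrable_ball(1)[OF assms, of x c]
    unfolding set_lebesgue_integral_def set_integrable_def
    by (simp add: nn_integral_eq_integral)
qed

lemma mean_osc_energy:
  assumes "f \<in> Lp p \<mu>" "1 \<le> p" "0 < s"
  shows "energy p \<mu> s f UNIV = ennreal (1 / s powr p) * (\<integral>\<^sup>+x. ennreal (mean_osc p f s x) \<partial>\<mu>)"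
proof -
  have "1 / emeasure \<mu> (ball x s) * (\<integral>\<^sup>+y\<in>ball x s. ennreal (\<bar>f y - f x\<bar> powr p) \<partial>\<mu>)
      = ennreal (mean_osc p f s x)" for x
  proof -
    have "emeasure \<mu> (ball x s) = ennreal (measure \<mu> (ball x s))"
      using emeasure_ball[OF assms(3), of x] by (intro emeasure_eq_ennreal_measure) auto
    moreover have "0 \<le> (LINT y:ball x s|\<mu>. \<bar>f y - f x\<bar> powr p)"
      unfolding set_lebesgue_integral_def by (intro integral_nonneg_AE) auto
    moreover have "1 / ennreal v * ennreal J = ennreal (J / v)" if "0 < v" "0 \<le> J" for v J
    proof -
      have "1 / ennreal v = ennreal (1 / v)"
        using divide_ennreal[of 1 v] that by simp
      then show ?thesis using that by (simp flip: ennreal_mult)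
    qed
    ultimately show ?thesis
      using measure_ball[OF assms(3), of x]
      by (simp add: set_nn_integral_ball[OF assms] mean_osc_def)
  qed
  then show ?thesis unfolding energy_def by simp
qed

text \<open>As \<open>'a\<close> need not be second countable as a type, product measurability is not available:
  instead the value \<open>f x\<close> is discretised, and each average with a fixed constant is
  lower semicontinuous.\<close>

lemma mean_osc_measurable:
  assumes f: "f \<in> Lp p \<mu>" and p: "1 \<le> p" and s: "0 < s"
  shows "mean_osc p f s \<in> borel_measurable \<mu>"
proof -
  have m [measurable]: "f \<in> borel_measurable borel" using f LpD(1)[OF f] by simp
  have meas: "(\<lambda>y. indicator (ball x s) y *\<^sub>R (\<bar>f y - c\<bar> powr p)) \<in> borel_measurable borel"
    for x c
    by (intro borel_measurable_scaleR borel_measurable_indicator) (simp, measurable)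
  define \<Psi> where "\<Psi> c x = (LINT y:ball x s|\<mu>. \<bar>f y - c\<bar> powr p)" for c x
  have \<Psi>m: "\<Psi> c \<in> borel_measurable borel" for c
  proof -
    \<comment> \<open>The integral over a ball is the mass of that ball under a measure with
      density, so measurability in the centre follows as for \<open>\<mu>\<close> itself.\<close>
    let ?N = "density \<mu> (\<lambda>y. ennreal (\<bar>f y - c\<bar> powr p))"
    have "\<Psi> c = (\<lambda>x. enn2real (emeasure ?N (ball x s)))"
    proof
      fix x
      have "emeasure ?N (ball x s) = (\<integral>\<^sup>+y\<in>ball x s. ennreal (\<bar>f y - c\<bar> powr p) \<partial>\<mu>)"
        by (subst emeasure_density) auto
      also have "\<dots> = ennreal (\<Psi> c x)"
        unfolding \<Psi>_def by (rule set_nn_integral_ball[OF f p s])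
      finally show "\<Psi> c x = enn2real (emeasure ?N (ball x s))"
        unfolding \<Psi>_def set_lebesgue_integral_def
        by (simp add: integral_nonneg_AE)
    qed
    moreover have "(\<lambda>x. emeasure ?N (ball x s)) \<in> borel_measurable borel"
      by (rule emeasure_ball_measurable) simp
    ultimately show ?thesis by simp
  qed
  \<comment> \<open>Rounding \<open>f x\<close> down to a multiple of \<open>1 / 2 ^ n\<close>
    leaves countably many values, hence a measurable composition. The rounding error is at most 1,
    which yields one dominating function for all \<open>n\<close>.\<close>
  define c where "c n x = real_of_int \<lfloor>2 ^ n * f x\<rfloor> / 2 ^ n" for n x
  have c_le: "c n x \<le> f x" "f x - c n x \<le> 1 / 2 ^ n" for n x
  proof -
    have "real_of_int \<lfloor>2 ^ n * f x\<rfloor> / 2 ^ n \<le> (2 ^ n * f x) / 2 ^ n"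
      "(2 ^ n * f x) / 2 ^ n \<le> (real_of_int \<lfloor>2 ^ n * f x\<rfloor> + 1) / 2 ^ n"
      by (rule divide_right_mono, linarith, simp)+
    then show "c n x \<le> f x" "f x - c n x \<le> 1 / 2 ^ n"
      unfolding c_def by (simp_all add: add_divide_distrib)
  qed
  have c_lim: "(\<lambda>n. c n x) \<longlonglongrightarrow> f x" for x
  proof (rule LIM_zero_cancel, rule Lim_null_comparison)
    show "(\<lambda>n. (1 / 2 :: real) ^ n) \<longlonglongrightarrow> 0"
      by (rule LIMSEQ_realpow_zero) simp_all
    show "\<forall>\<^sub>F n in sequentially. norm (c n x - f x) \<le> (1 / 2) ^ n"
      using c_le[where x = x] by (intro always_eventually allI) (simp add: power_one_over)
  qed
  have \<Psi>_lim: "(\<lambda>n. \<Psi> (c n x) x) \<longlonglongrightarrow> \<Psi> (f x) x" for x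
    unfolding \<Psi>_def set_lebesgue_integral_def
  proof (rule integral_dominated_convergence)
    let ?g = "\<lambda>y. 2 powr p * (\<bar>f y - f x\<bar> powr p + 1)"
    have "set_integrable \<mu> (ball x s) (\<lambda>y. 1::real)"
      using emeasure_ball[OF s] unfolding set_integrable_def
      by (intro integrable_scaleR_left) simp_all
    then have "set_integrable \<mu> (ball x s) ?g"
      by (intro set_integrable_mult_right set_integral_add Lp_set_integrable_ball(1)[OF f p s])
    then show "integrable \<mu> (\<lambda>y. indicator (ball x s) y *\<^sub>R ?g y)"
      by (simp add: set_integrable_def)
    show "AE y in \<mu>. (\<lambda>n. indicator (ball x s) y *\<^sub>R (\<bar>f y - c n x\<bar> powr p))
        \<longlonglongrightarrow> indicator (ball x s) y *\<^sub>R (\<bar>f y - f x\<bar> powr p)"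
      using p by (intro AE_I2 tendsto_scaleR tendsto_const tendsto_powr2 tendsto_rabs tendsto_diff
        c_lim) auto
    show "AE y in \<mu>. norm (indicator (ball x s) y *\<^sub>R (\<bar>f y - c n x\<bar> powr p))
        \<le> indicator (ball x s) y *\<^sub>R ?g y" for n
    proof (intro AE_I2)
      fix y
      have "1 / 2 ^ n \<le> (1::real)" by simp
      then have "\<bar>f y - c n x\<bar> \<le> \<bar>f y - f x\<bar> + 1"
        using c_le[where n = n and x = x] by linarith
      then have "\<bar>f y - c n x\<bar> powr p \<le> (\<bar>f y - f x\<bar> + 1) powr p"
        using p by (intro powr_mono2) auto
      also have "\<dots> \<le> ?g y"
        using powr_add_le[of "\<bar>f y - f x\<bar>" 1 p] p by simp
      finally show "norm (indicator (ball x s) y *\<^sub>R (\<bar>f y - c n x\<bar> powr p))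
        \<le> indicator (ball x s) y *\<^sub>R ?g y"
        by (auto simp: indicator_def)
    qed
  qed (use meas in \<open>simp_all add: measurable_cong_sets[OF sets_eq refl]\<close>)
  have "(\<lambda>x. \<Psi> (c n x) x) \<in> borel_measurable borel" for n
  proof -
    have "(\<lambda>x. (\<lambda>k::int. \<Psi> (real_of_int k / 2 ^ n)) \<lfloor>2 ^ n * f x\<rfloor> x) \<in> borel_measurable borel"
      by (rule measurable_compose_countable[OF \<Psi>m]) measurable
    then show ?thesis by (simp add: c_def)
  qed
  then have "(\<lambda>x. \<Psi> (f x) x) \<in> borel_measurable borel"
    using \<Psi>_lim by (rule borel_measurable_LIMSEQ_metric)
  moreover have "(\<lambda>x. measure \<mu> (ball x s)) \<in> borel_measurable borel"
    unfolding measure_def using emeasure_ball_measurable[OF sets_eq] by measurable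
  ultimately have "(\<lambda>x. \<Psi> (f x) x / measure \<mu> (ball x s)) \<in> borel_measurable borel"
    by measurable
  then show ?thesis
    by (simp add: mean_osc_def[abs_def] \<Psi>_def)
qed

end

subsection \<open>Mollification\<close>

context doubling
begin

lemma measure_ball_mono:
  assumes "ball x s \<subseteq> ball y t" "0 < t"
  shows "measure \<mu> (ball x s) \<le> measure \<mu> (ball y t)"
  using emeasure_ball[OF assms(2), of y] assms(1)
  by (intro measure_mono_fmeasurable) (simp_all add: fmeasurable_def)

text \<open>The weight may change sign: the bounds serve for a single bump with \<open>b = 1\<close>
  and for the difference of two bumps, where \<open>b\<close> is proportional to the distance of
  their centres.\<close>

lemma
  fixes \<psi> f :: "'a \<Rightarrow> real"
  assumes \<psi>: "\<psi> \<in> borel_measurable \<mu>" "\<And>y. \<bar>\<psi> y\<bar> \<le> b * indicator (ball x s) y" and s: "0 < s"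
  shows integrable_weight: "integrable \<mu> \<psi>"
    and integral_weight_le: "\<bar>LINT y|\<mu>. \<psi> y\<bar> \<le> b * measure \<mu> (ball x s)"
    and integrable_weighted: "set_integrable \<mu> (ball x s) f \<Longrightarrow> f \<in> borel_measurable \<mu> \<Longrightarrow>
      integrable \<mu> (\<lambda>y. \<psi> y * f y)"
    and integral_weighted_le: "set_integrable \<mu> (ball x s) f \<Longrightarrow> f \<in> borel_measurable \<mu> \<Longrightarrow>
      \<bar>LINT y|\<mu>. \<psi> y * f y\<bar> \<le> b * (LINT y:ball x s|\<mu>. \<bar>f y\<bar>)"
proof -
  have i: "integrable \<mu> (\<lambda>y. b * indicator (ball x s) y)"
    using emeasure_ball[OF s, of x]
    by (intro integrable_mult_right integrable_real_indicator) simp_all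
  show 1: "integrable \<mu> \<psi>"
    using \<psi> by (intro Bochner_Integration.integrable_bound[OF i])
      (simp_all add: order_trans[OF \<psi>(2)])
  have "\<bar>LINT y|\<mu>. \<psi> y\<bar> \<le> (LINT y|\<mu>. \<bar>\<psi> y\<bar>)"
    using integral_abs_bound by blast
  also have "\<dots> \<le> (LINT y|\<mu>. b * indicator (ball x s) y)"
    using 1 i \<psi>(2) by (intro integral_mono integrable_abs) simp_all
  also have "\<dots> = b * measure \<mu> (ball x s)" by simp
  finally show "\<bar>LINT y|\<mu>. \<psi> y\<bar> \<le> b * measure \<mu> (ball x s)" .
  assume f: "set_integrable \<mu> (ball x s) f" and m: "f \<in> borel_measurable \<mu>"
  have j: "integrable \<mu> (\<lambda>y. b * (indicator (ball x s) y *\<^sub>R \<bar>f y\<bar>))"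
    using set_integrable_abs[OF f] unfolding set_integrable_def by (rule integrable_mult_right)
  have le: "\<bar>\<psi> y * f y\<bar> \<le> b * (indicator (ball x s) y *\<^sub>R \<bar>f y\<bar>)" for y
    using mult_right_mono[OF \<psi>(2)[of y], of "\<bar>f y\<bar>"] by (simp add: abs_mult mult.assoc)
  show 2: "integrable \<mu> (\<lambda>y. \<psi> y * f y)"
    using \<psi> m by (intro Bochner_Integration.integrable_bound[OF j] AE_I2)
      (simp_all add: order_trans[OF le] del: scaleR_conv_of_real real_scaleR_def)
  have "\<bar>LINT y|\<mu>. \<psi> y * f y\<bar> \<le> (LINT y|\<mu>. \<bar>\<psi> y * f y\<bar>)"
    using integral_abs_bound by blast
  also have "\<dots> \<le> (LINT y|\<mu>. b * (indicator (ball x s) y *\<^sub>R \<bar>f y\<bar>))"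
    using 2 j le by (intro integral_mono integrable_abs)
  also have "\<dots> = b * (LINT y:ball x s|\<mu>. \<bar>f y\<bar>)"
    unfolding set_lebesgue_integral_def by (rule integral_mult_right_zero)
  finally show "\<bar>LINT y|\<mu>. \<psi> y * f y\<bar> \<le> b * (LINT y:ball x s|\<mu>. \<bar>f y\<bar>)" .
qed

text \<open>A tent around \<open>x\<close>; for positive \<open>\<epsilon>\<close> it is Lipschitz
  in its centre with constant \<open>1 / \<epsilon>\<close>.\<close>

definition bump :: "real \<Rightarrow> 'a \<Rightarrow> 'a \<Rightarrow> real" where
  "bump \<epsilon> x y = max 0 (1 - dist x y / \<epsilon>)"

text \<open>Dividing by the integral of the bump makes constants reproduce themselves, so a constant
  can be subtracted from \<open>f\<close> before estimating.\<close>

definition mollify :: "real \<Rightarrow> ('a \<Rightarrow> real) \<Rightarrow> 'a \<Rightarrow> real" where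
  "mollify \<epsilon> f x = (LINT y|\<mu>. bump \<epsilon> x y * f y) / (LINT y|\<mu>. bump \<epsilon> x y)"

lemma bump_measurable: "bump \<epsilon> x \<in> borel_measurable \<mu>"
proof -
  have "continuous_on UNIV (bump \<epsilon> x)"
    unfolding bump_def divide_inverse by (intro continuous_intros)
  then have "bump \<epsilon> x \<in> borel_measurable borel"
    by (rule borel_measurable_continuous_onI)
  then show ?thesis by (simp add: measurable_cong_sets[OF sets_eq refl])
qed

text \<open>The support is recorded in a ball around \<open>x\<close> rather than \<open>z\<close>,
  so that all centres \<open>z\<close> near \<open>x\<close> share one domain of
  integration.\<close>

lemma bump_le:
  assumes "0 < \<epsilon>" "dist x z < \<epsilon>"
  shows "\<bar>bump \<epsilon> z y\<bar> \<le> 1 * indicator (ball x (2 * \<epsilon>)) y"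
proof (cases "dist x y < 2 * \<epsilon>")
  case False
  then have "\<epsilon> \<le> dist z y" using assms dist_triangle[of x y z] by linarith
  then show ?thesis using assms by (simp add: bump_def)
qed (use assms in \<open>simp add: bump_def\<close>)

lemma bump_diff_le:
  assumes "0 < \<epsilon>" "dist x z < \<epsilon>"
  shows "\<bar>bump \<epsilon> z y - bump \<epsilon> x y\<bar> \<le> dist x z / \<epsilon> * indicator (ball x (2 * \<epsilon>)) y"
proof (cases "dist x y < 2 * \<epsilon>")
  case False
  then show ?thesis
    using bump_le[OF assms, of y] bump_le[of \<epsilon> x x y] assms by simp
next
  case True
  have "\<bar>dist z y / \<epsilon> - dist x y / \<epsilon>\<bar> = \<bar>dist z y - dist x y\<bar> / \<epsilon>"
    using assms by (simp flip: diff_divide_distrib)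
  also have "\<bar>dist z y - dist x y\<bar> / \<epsilon> \<le> dist x z / \<epsilon>"
    using assms dist_triangle[of x y z] dist_triangle[of z y x]
    by (intro divide_right_mono) (simp_all add: dist_commute)
  finally have "\<bar>dist z y / \<epsilon> - dist x y / \<epsilon>\<bar> \<le> dist x z / \<epsilon>" .
  moreover have "\<bar>max 0 (1 - a) - max 0 (1 - b)\<bar> \<le> \<bar>a - b\<bar>" for a b :: real
    by linarith
  ultimately show ?thesis
    using True unfolding bump_def by (simp add: order_trans)
qed

text \<open>The ball around \<open>x\<close> lies in the ball around \<open>z\<close> of radius
  \<open>4 * \<epsilon>\<close>, which is reached from radius \<open>\<epsilon> / 2\<close> by three
  doublings. On that smallest ball the bump is at least \<open>1 / 2\<close>, which gives the factor
  2.\<close>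

lemma bump_integral_ge:
  assumes \<epsilon>: "0 < \<epsilon>" and z: "dist x z < \<epsilon>"
  shows "measure \<mu> (ball x (2 * \<epsilon>)) \<le> 2 * C ^ 3 * (LINT y|\<mu>. bump \<epsilon> z y)"
proof -
  have "ball x (2 * \<epsilon>) \<subseteq> ball z (2 * (2 * (2 * (\<epsilon> / 2))))"
  proof
    fix y assume "y \<in> ball x (2 * \<epsilon>)"
    then show "y \<in> ball z (2 * (2 * (2 * (\<epsilon> / 2))))"
      using z \<epsilon> dist_triangle[of z y x] by (simp add: dist_commute)
  qed
  then have "measure \<mu> (ball x (2 * \<epsilon>)) \<le> measure \<mu> (ball z (2 * (2 * (2 * (\<epsilon> / 2)))))"
    using \<epsilon> by (intro measure_ball_mono) simp_all
  also have "\<dots> \<le> C * measure \<mu> (ball z (2 * (2 * (\<epsilon> / 2))))"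
    using \<epsilon> by (intro measure_double) simp
  also have "\<dots> \<le> C * (C * measure \<mu> (ball z (2 * (\<epsilon> / 2))))"
    using \<epsilon> C_pos by (intro mult_left_mono measure_double) simp_all
  also have "\<dots> \<le> C * (C * (C * measure \<mu> (ball z (\<epsilon> / 2))))"
    using \<epsilon> C_pos by (intro mult_left_mono measure_double) simp_all
  also have "measure \<mu> (ball z (\<epsilon> / 2)) = 2 * (LINT y|\<mu>. 1 / 2 * indicator (ball z (\<epsilon> / 2)) y)"
    by simp
  also have "(LINT y|\<mu>. 1 / 2 * indicator (ball z (\<epsilon> / 2)) y) \<le> (LINT y|\<mu>. bump \<epsilon> z y)"
  proof (rule integral_mono)
    show "integrable \<mu> (\<lambda>y. 1 / 2 * indicator (ball z (\<epsilon> / 2)) y :: real)"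
      using emeasure_ball[of "\<epsilon> / 2" z] \<epsilon>
      by (intro integrable_mult_right integrable_real_indicator) simp_all
    show "integrable \<mu> (bump \<epsilon> z)"
      using \<epsilon> by (intro integrable_weight[OF bump_measurable bump_le[of _ z]]) simp_all
    show "1 / 2 * indicator (ball z (\<epsilon> / 2)) y \<le> bump \<epsilon> z y" for y
      using \<epsilon> by (simp add: bump_def indicator_def max_def field_simps)
  qed
  finally show ?thesis using C_pos by (simp add: power3_eq_cube mult.assoc)
qed

text \<open>Subtracting the constant \<open>c = f x\<close> from \<open>f\<close> makes both the oscillation and the error of the
  mollification controlled by the energy density at the single point \<open>x\<close>.\<close>

lemma mollify_bounds:
  assumes f: "f \<in> Lp p \<mu>" and p: "1 < p" and \<epsilon>: "0 < \<epsilon>"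
    and k: "k = 2 * C ^ 3" and K: "K = 2 * (k + k\<^sup>2)"
  defines "g \<equiv> \<lambda>x. K * mean_osc p f (2 * \<epsilon>) x powr (1 / p)"
  shows "dist x z < \<epsilon> \<Longrightarrow> \<bar>mollify \<epsilon> f z - mollify \<epsilon> f x\<bar> \<le> g x / \<epsilon> * dist x z"
    and "\<bar>mollify \<epsilon> f x - f x\<bar> \<le> g x"
proof -
  define c where "c = f x"
  define V where "V = measure \<mu> (ball x (2 * \<epsilon>))"
  define I where "I = (LINT y:ball x (2 * \<epsilon>)|\<mu>. \<bar>f y - c\<bar>)"
  define \<Phi> where "\<Phi> z = (LINT y|\<mu>. bump \<epsilon> z y)" for z
  define N where "N z = (LINT y|\<mu>. bump \<epsilon> z y * (f y - c))" for z
  have m: "f \<in> borel_measurable \<mu>" "(\<lambda>y. f y - c) \<in> borel_measurable \<mu>"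
    using LpD(1)[OF f] by simp_all
  have \<epsilon>2: "0 < 2 * \<epsilon>" using \<epsilon> by simp
  have V: "0 < V" unfolding V_def using \<epsilon>2 by (rule measure_ball)
  have k0: "0 < k" using k C_pos by simp
  have I0: "0 \<le> I" unfolding I_def set_lebesgue_integral_def
    by (intro integral_nonneg_AE) auto
  have si: "set_integrable \<mu> (ball x (2 * \<epsilon>)) (\<lambda>y. f y - b)" for b
    using p by (intro Lp_set_integrable_ball(2)[OF f _ \<epsilon>2]) simp
  have IV: "I / V \<le> 2 * mean_osc p f (2 * \<epsilon>) x powr (1 / p)"
    unfolding I_def V_def mean_osc_def c_def
    using p measure_ball[OF \<epsilon>2] emeasure_ball[OF \<epsilon>2] Lp_set_integrable_ball(1)[OF f _ \<epsilon>2]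
      set_integrable_abs[OF si]
    by (intro mean_le_powr_mean) simp_all
  \<comment> \<open>The factor 2 in \<open>K\<close> comes from \<open>IV\<close>; \<open>k\<close>
    and \<open>k\<^sup>2\<close> will bound the two terms of the difference of quotients
    below.\<close>
  have Ig: "(k + k\<^sup>2) * (I / V) \<le> g x"
    using mult_left_mono[OF IV, of "k + k\<^sup>2"] k0 by (simp add: g_def K algebra_simps)
  have \<Phi>: "V \<le> k * \<Phi> z" "0 < \<Phi> z" "\<bar>N z\<bar> \<le> I" "mollify \<epsilon> f z = c + N z / \<Phi> z"
    if z: "dist x z < \<epsilon>" for z
  proof -
    note w = bump_measurable bump_le[OF \<epsilon> z] \<epsilon>2
    show 1: "V \<le> k * \<Phi> z"
      unfolding V_def k \<Phi>_def by (rule bump_integral_ge[OF \<epsilon> z])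
    then show 2: "0 < \<Phi> z" using V k0 by (smt (verit) zero_less_mult_pos)
    show "\<bar>N z\<bar> \<le> I"
      unfolding N_def I_def using integral_weighted_le[OF w si m(2)] by simp
    have "(LINT y|\<mu>. bump \<epsilon> z y * f y) = (LINT y|\<mu>. bump \<epsilon> z y * (f y - c) + c * bump \<epsilon> z y)"
      by (simp add: algebra_simps)
    also have "\<dots> = N z + c * \<Phi> z"
      unfolding N_def \<Phi>_def
      using integrable_weighted[OF w si m(2)] integrable_weight[OF w]
      by (subst Bochner_Integration.integral_add) simp_all
    finally show "mollify \<epsilon> f z = c + N z / \<Phi> z"
      using 2 by (simp add: mollify_def \<Phi>_def[symmetric] field_simps)
  qed
  have x: "dist x x < \<epsilon>" using \<epsilon> by simp
  have inv: "I / \<Phi> z \<le> k * (I / V)" if "dist x z < \<epsilon>" for z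
  proof -
    have "I * V \<le> I * (k * \<Phi> z)" using I0 \<Phi>(1)[OF that] by (intro mult_left_mono)
    then show ?thesis using V \<Phi>(2)[OF that] by (simp add: field_simps)
  qed
  have IV0: "0 \<le> I / V" using I0 V by simp
  have "\<bar>mollify \<epsilon> f x - f x\<bar> = \<bar>N x\<bar> / \<Phi> x"
    using \<Phi>[OF x] by (simp add: c_def)
  also have "\<dots> \<le> I / \<Phi> x" using \<Phi>[OF x] by (intro divide_right_mono) simp_all
  also have "\<dots> \<le> k * (I / V)" by (rule inv[OF x])
  also have "\<dots> \<le> (k + k\<^sup>2) * (I / V)" using IV0 by (intro mult_right_mono) simp_all
  also have "\<dots> \<le> g x"
    by (rule Ig)
  finally show "\<bar>mollify \<epsilon> f x - f x\<bar> \<le> g x" .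
  assume z: "dist x z < \<epsilon>"
  define t where "t = dist x z / \<epsilon>"
  have t0: "0 \<le> t" using \<epsilon> by (simp add: t_def)
  note w = bump_measurable[of \<epsilon> z] bump_measurable[of \<epsilon> x]
  have wd: "(\<lambda>y. bump \<epsilon> z y - bump \<epsilon> x y) \<in> borel_measurable \<mu>"
    using w by simp
  note d = wd bump_diff_le[OF \<epsilon> z, folded t_def] \<epsilon>2
  have int: "integrable \<mu> (bump \<epsilon> y)" "integrable \<mu> (\<lambda>u. bump \<epsilon> y u * (f u - c))"
    if "dist x y < \<epsilon>" for y
    using integrable_weight[OF bump_measurable bump_le[OF \<epsilon> that] \<epsilon>2]
      integrable_weighted[OF bump_measurable bump_le[OF \<epsilon> that] \<epsilon>2 si m(2)] by simp_all
  have "\<Phi> z - \<Phi> x = (LINT y|\<mu>. bump \<epsilon> z y - bump \<epsilon> x y)"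
    unfolding \<Phi>_def using int[OF z] int[OF x] by simp
  then have d\<Phi>: "\<bar>\<Phi> z - \<Phi> x\<bar> \<le> t * V"
    unfolding V_def using integral_weight_le[OF d] by simp
  have "N z - N x = (LINT y|\<mu>. (bump \<epsilon> z y - bump \<epsilon> x y) * (f y - c))"
    unfolding N_def left_diff_distrib using int[OF z] int[OF x] by simp
  then have dN: "\<bar>N z - N x\<bar> \<le> t * I"
    unfolding I_def using integral_weighted_le[OF d si m(2)] by simp
  \<comment> \<open>The numerator and the normalisation are varied one at a time; each variation
    carries one factor \<open>t\<close>.\<close>
  have "mollify \<epsilon> f z - mollify \<epsilon> f x = (N z - N x) / \<Phi> x - N z * (\<Phi> z - \<Phi> x) / (\<Phi> x * \<Phi> z)"
    using \<Phi>(2)[OF x] \<Phi>(2)[OF z] unfolding \<Phi>(4)[OF x] \<Phi>(4)[OF z] by (simp add: field_simps)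
  also have "\<bar>\<dots>\<bar> \<le> \<bar>(N z - N x) / \<Phi> x\<bar> + \<bar>N z * (\<Phi> z - \<Phi> x) / (\<Phi> x * \<Phi> z)\<bar>"
    by (rule abs_triangle_ineq4)
  also have "\<bar>(N z - N x) / \<Phi> x\<bar> \<le> t * I / \<Phi> x"
    using dN \<Phi>(2)[OF x] by (simp add: divide_right_mono)
  also have "t * I / \<Phi> x \<le> t * (k * (I / V))"
    using mult_left_mono[OF inv[OF x] t0] by simp
  also have "\<bar>N z * (\<Phi> z - \<Phi> x) / (\<Phi> x * \<Phi> z)\<bar> \<le> I * (t * V) / (\<Phi> x * \<Phi> z)"
    using \<Phi>(2)[OF x] \<Phi>(2)[OF z] mult_mono[OF \<Phi>(3)[OF z] d\<Phi>] I0
    by (simp add: abs_mult divide_right_mono)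
  also have "\<dots> = t * V / \<Phi> z * (I / \<Phi> x)" by (simp add: ac_simps)
  also have "\<dots> \<le> t * k * (k * (I / V))"
  proof (intro mult_mono inv[OF x])
    have "t * V \<le> t * (k * \<Phi> z)" using \<Phi>(1)[OF z] t0 by (rule mult_left_mono)
    then show "t * V / \<Phi> z \<le> t * k" using \<Phi>(2)[OF z] by (simp add: field_simps)
  qed (use t0 k0 I0 \<Phi>(2)[OF x] in simp_all)
  also have "t * (k * (I / V)) + t * k * (k * (I / V)) = (k + k\<^sup>2) * (I / V) * t"
    by (simp add: algebra_simps power2_eq_square add_divide_distrib)
  also have "\<dots> \<le> g x * t"
    by (rule mult_right_mono[OF Ig t0])
  finally show "\<bar>mollify \<epsilon> f z - mollify \<epsilon> f x\<bar> \<le> g x / \<epsilon> * dist x z"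
    by (simp add: t_def)
qed

end

subsection \<open>Pairs of functions and small-scale gradients\<close>

text \<open>The slope \<open>G x\<close> belongs to one end point only, matching the outer variable
  of \<open>energy\<close>. All conditions are stable under averaging two pairs, once
  \<open>\<rho>\<close> is shrunk to the smaller scale.\<close>

definition gradient_pair ::
    "real \<Rightarrow> 'a::metric_space measure \<Rightarrow> ('a \<Rightarrow> real) \<Rightarrow> real \<Rightarrow> real \<Rightarrow> ('a \<Rightarrow> real) \<Rightarrow> ('a \<Rightarrow> real) \<Rightarrow> bool"
  where "gradient_pair p \<mu> f \<delta> \<rho> h G \<longleftrightarrow> h \<in> Lp p \<mu> \<and> G \<in> Lp p \<mu> \<and> (\<forall>x. 0 \<le> G x) \<and> 0 < \<rho>
    \<and> (\<forall>x z. dist x z < \<rho> \<longrightarrow> \<bar>h z - h x\<bar> \<le> G x * dist x z)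
    \<and> (LINT x|\<mu>. \<bar>h x - f x\<bar> powr p) \<le> \<delta>"

lemma gradient_pairD:
  assumes "gradient_pair p \<mu> f \<delta> \<rho> h G"
  shows "h \<in> Lp p \<mu>" "G \<in> Lp p \<mu>" "0 \<le> G x" "0 < \<rho>"
    "dist x z < \<rho> \<Longrightarrow> \<bar>h z - h x\<bar> \<le> G x * dist x z"
    "(LINT x|\<mu>. \<bar>h x - f x\<bar> powr p) \<le> \<delta>"
    "integrable \<mu> (\<lambda>x. G x powr p)"
  using assms LpD(2)[of G p \<mu>] by (auto simp: gradient_pair_def)

lemma gradient_pair_mono:
  "gradient_pair p \<mu> f \<delta> \<rho> h G \<Longrightarrow> \<delta> \<le> \<delta>' \<Longrightarrow> gradient_pair p \<mu> f \<delta>' \<rho> h G"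
  by (auto simp: gradient_pair_def)

text \<open>The slope condition is linear in the pair, and the closeness condition is convex because
  \<open>t powr p\<close> is. This makes midpoints admissible competitors in the
  minimisation.\<close>

lemma gradient_pair_midpoint:
  assumes p: "1 \<le> p" and f: "f \<in> Lp p \<mu>"
    and 1: "gradient_pair p \<mu> f \<delta> \<rho> h G" and 2: "gradient_pair p \<mu> f \<delta> \<rho>' h' G'"
  shows "gradient_pair p \<mu> f \<delta> (min \<rho> \<rho>') (\<lambda>x. (h x + h' x) / 2) (\<lambda>x. (G x + G' x) / 2)"
  unfolding gradient_pair_def
proof (intro conjI allI impI)
  note a = gradient_pairD[OF 1] and b = gradient_pairD[OF 2]
  show mid: "(\<lambda>x. (h x + h' x) / 2) \<in> Lp p \<mu>" "(\<lambda>x. (G x + G' x) / 2) \<in> Lp p \<mu>"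
    using Lp_cmult[OF Lp_add[OF a(1) b(1)], of "1/2"] Lp_cmult[OF Lp_add[OF a(2) b(2)], of "1/2"] p
    by simp_all
  show "0 \<le> (G x + G' x) / 2" for x using a(3)[of x] b(3)[of x] by simp
  show "0 < min \<rho> \<rho>'" using a(4) b(4) by simp
  show "\<bar>(h z + h' z) / 2 - (h x + h' x) / 2\<bar> \<le> (G x + G' x) / 2 * dist x z"
    if "dist x z < min \<rho> \<rho>'" for x z
  proof -
    have "\<bar>h z - h x\<bar> \<le> G x * dist x z" "\<bar>h' z - h' x\<bar> \<le> G' x * dist x z"
      using a(5) b(5) that by simp_all
    then have "\<bar>(h z + h' z) - (h x + h' x)\<bar> \<le> (G x + G' x) * dist x z"
      unfolding distrib_right by linarith
    then show ?thesis by (simp flip: diff_divide_distrib)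
  qed
  have i: "integrable \<mu> (\<lambda>x. \<bar>h x - f x\<bar> powr p)" "integrable \<mu> (\<lambda>x. \<bar>h' x - f x\<bar> powr p)"
    using LpD(2)[OF Lp_diff[OF a(1) f]] LpD(2)[OF Lp_diff[OF b(1) f]] p by simp_all
  have "(LINT x|\<mu>. \<bar>(h x + h' x) / 2 - f x\<bar> powr p)
      \<le> (LINT x|\<mu>. (\<bar>h x - f x\<bar> powr p + \<bar>h' x - f x\<bar> powr p) / 2)"
  proof (rule integral_mono)
    show "integrable \<mu> (\<lambda>x. \<bar>(h x + h' x) / 2 - f x\<bar> powr p)"
      using LpD(2)[OF Lp_diff[OF mid(1) f]] p by simp
    show "\<bar>(h x + h' x) / 2 - f x\<bar> powr p \<le> (\<bar>h x - f x\<bar> powr p + \<bar>h' x - f x\<bar> powr p) / 2" for x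
    proof -
      have "\<bar>(h x + h' x) / 2 - f x\<bar> \<le> (\<bar>h x - f x\<bar> + \<bar>h' x - f x\<bar>) / 2"
        by (simp add: field_simps)
      then have "\<bar>(h x + h' x) / 2 - f x\<bar> powr p \<le> ((\<bar>h x - f x\<bar> + \<bar>h' x - f x\<bar>) / 2) powr p"
        using p by (intro powr_mono2) simp_all
      also have "\<dots> \<le> (\<bar>h x - f x\<bar> powr p + \<bar>h' x - f x\<bar> powr p) / 2"
        using p by (intro powr_midpoint_le) simp_all
      finally show ?thesis .
    qed
  qed (use i in simp)
  also have "\<dots> = ((LINT x|\<mu>. \<bar>h x - f x\<bar> powr p) + (LINT x|\<mu>. \<bar>h' x - f x\<bar> powr p)) / 2"
    using i by simp
  also have "\<dots> \<le> \<delta>" using a(6) b(6) by simp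
  finally show "(LINT x|\<mu>. \<bar>(h x + h' x) / 2 - f x\<bar> powr p) \<le> \<delta>" .
qed

context doubling
begin

text \<open>Below scale \<open>\<rho>\<close> the inner average at \<open>x\<close> is at most
  \<open>(G x * s) powr p\<close>, and the normalising factor of the energy cancels
  \<open>s powr p\<close>. The bound is therefore uniform in \<open>s\<close>.\<close>

lemma energy_gradient_pair_le:
  assumes gp: "gradient_pair p \<mu> f \<delta> \<rho> h G" and p: "1 \<le> p" and s: "0 < s" "s < \<rho>"
    and U: "U \<in> sets borel"
  shows "energy p \<mu> s h U \<le> ennreal (LINT x:U|\<mu>. G x powr p)"
proof -
  note a = gradient_pairD[OF gp]
  have inner: "1 / emeasure \<mu> (ball x s) * (\<integral>\<^sup>+y\<in>ball x s. ennreal (\<bar>h y - h x\<bar> powr p) \<partial>\<mu>)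
      \<le> ennreal (s powr p) * ennreal (G x powr p)" for x
  proof -
    have e: "emeasure \<mu> (ball x s) \<noteq> 0" "emeasure \<mu> (ball x s) \<noteq> \<infinity>"
      using emeasure_ball[OF s(1), of x] measure_ball[OF s(1), of x] by (auto simp: measure_def)
    have "(\<integral>\<^sup>+y\<in>ball x s. ennreal (\<bar>h y - h x\<bar> powr p) \<partial>\<mu>)
        \<le> (\<integral>\<^sup>+y. ennreal ((G x * s) powr p) * indicator (ball x s) y \<partial>\<mu>)"
    proof (rule nn_integral_mono)
      fix y
      show "ennreal (\<bar>h y - h x\<bar> powr p) * indicator (ball x s) y
        \<le> ennreal ((G x * s) powr p) * indicator (ball x s) y"
      proof (cases "y \<in> ball x s")
        case True
        then have "\<bar>h y - h x\<bar> \<le> G x * dist x y" using a(5) s by simp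
        also have "\<dots> \<le> G x * s" using True a(3) by (intro mult_left_mono) simp_all
        finally have "\<bar>h y - h x\<bar> powr p \<le> (G x * s) powr p"
          using p by (intro powr_mono2) simp_all
        then show ?thesis by (intro mult_right_mono ennreal_leI) simp_all
      qed simp
    qed
    also have "\<dots> = ennreal ((G x * s) powr p) * emeasure \<mu> (ball x s)"
      by (rule nn_integral_cmult_indicator) simp
    finally have "1 / emeasure \<mu> (ball x s) * (\<integral>\<^sup>+y\<in>ball x s. ennreal (\<bar>h y - h x\<bar> powr p) \<partial>\<mu>)
      \<le> 1 / emeasure \<mu> (ball x s) * (ennreal ((G x * s) powr p) * emeasure \<mu> (ball x s))"
      by (rule mult_left_mono) simp
    also have "\<dots> = ennreal ((G x * s) powr p) * (emeasure \<mu> (ball x s) / emeasure \<mu> (ball x s))"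
      by (simp add: divide_ennreal_def mult_ac)
    also have "\<dots> = ennreal ((G x * s) powr p)"
      using e by (simp add: ennreal_divide_self top.not_eq_extremum)
    also have "\<dots> = ennreal (s powr p) * ennreal (G x powr p)"
      using a(3) s by (simp add: powr_mult mult.commute flip: ennreal_mult)
    finally show ?thesis .
  qed
  have GU: "set_integrable \<mu> U (\<lambda>x. G x powr p)"
    using a(7) U unfolding set_integrable_def by (intro integrable_mult_indicator) simp_all
  have m: "(\<lambda>x. ennreal (indicator U x *\<^sub>R G x powr p)) \<in> borel_measurable \<mu>"
    using borel_measurable_integrable[OF GU[unfolded set_integrable_def]] by simp
  have "energy p \<mu> s h U
      \<le> ennreal (1 / s powr p) * (\<integral>\<^sup>+x. ennreal (s powr p) * ennreal (indicator U x *\<^sub>R G x powr p) \<partial>\<mu>)"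
    unfolding energy_def
  proof (intro mult_left_mono nn_integral_mono)
    fix x
    show "1 / emeasure \<mu> (ball x s) * (\<integral>\<^sup>+y\<in>ball x s. ennreal (\<bar>h y - h x\<bar> powr p) \<partial>\<mu>) * indicator U x
      \<le> ennreal (s powr p) * ennreal (indicator U x *\<^sub>R G x powr p)"
      using inner[of x] by (cases "x \<in> U") simp_all
  qed simp
  also have "\<dots> = ennreal (1 / s powr p) * (ennreal (s powr p) * (\<integral>\<^sup>+x. ennreal (indicator U x *\<^sub>R G x powr p) \<partial>\<mu>))"
    by (subst nn_integral_cmult[OF m]) simp
  also have "\<dots> = (\<integral>\<^sup>+x. ennreal (indicator U x *\<^sub>R G x powr p) \<partial>\<mu>)"
    using s by (simp add: mult.assoc[symmetric] flip: ennreal_mult)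
  also have "\<dots> = ennreal (LINT x:U|\<mu>. G x powr p)"
    unfolding set_lebesgue_integral_def using GU[unfolded set_integrable_def]
    by (intro nn_integral_eq_integral) simp_all
  finally show ?thesis .
qed

text \<open>The pair is the mollification at scale \<open>\<epsilon>\<close> with its slope bound.
  In the integral of \<open>G powr p\<close> the factors \<open>(K / \<epsilon>) powr p\<close> and
  \<open>(2 * \<epsilon>) powr p\<close> combine to \<open>(2 * K) powr p\<close>, so
  \<open>M'\<close> does not depend on \<open>\<delta>\<close>.\<close>

lemma gradient_pair_exists:
  assumes p: "1 < p" and f: "f \<in> Lp p \<mu>" and s0: "0 < s0"
    and M: "0 \<le> M" "\<And>s. 0 < s \<Longrightarrow> s < s0 \<Longrightarrow> energy p \<mu> s f UNIV \<le> ennreal M"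
  obtains M' where "\<And>\<delta>. 0 < \<delta> \<Longrightarrow> \<exists>\<rho> h G. gradient_pair p \<mu> f \<delta> \<rho> h G \<and> (LINT x|\<mu>. G x powr p) \<le> M'"
proof -
  define k where "k = 2 * C ^ 3"
  define K where "K = 2 * (k + k\<^sup>2)"
  have "0 < k" using C_pos by (simp add: k_def)
  then have K: "0 < K" by (simp add: K_def add_pos_pos)
  define M' where "M' = (2 * K) powr p * M"
  have M': "0 \<le> M'" using M by (simp add: M'_def)
  have "\<exists>\<rho> h G. gradient_pair p \<mu> f \<delta> \<rho> h G \<and> (LINT x|\<mu>. G x powr p) \<le> M'" if \<delta>: "0 < \<delta>" for \<delta>
  proof -
    \<comment> \<open>The first entry keeps \<open>2 * \<epsilon>\<close> below \<open>s0\<close>.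
      The second makes \<open>\<epsilon> powr p * M'\<close> at most \<open>\<delta>\<close>, which
      suffices since the error is at most \<open>\<epsilon> * G x\<close>; adding 1 avoids a zero
      denominator.\<close>
    define \<epsilon> where "\<epsilon> = min (s0 / 4) ((\<delta> / (M' + 1)) powr (1 / p))"
    have \<epsilon>: "0 < \<epsilon>" "2 * \<epsilon> < s0" using s0 \<delta> M' by (auto simp: \<epsilon>_def min_def)
    have \<epsilon>2: "0 < 2 * \<epsilon>" using \<epsilon> by simp
    have p1: "1 \<le> p" using p by simp
    let ?o = "mean_osc p f (2 * \<epsilon>)"
    define G where "G x = K * ?o x powr (1 / p) / \<epsilon>" for x
    define h where "h = mollify \<epsilon> f"
    have om: "?o \<in> borel_measurable \<mu>" by (rule mean_osc_measurable[OF f p1 \<epsilon>2])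
    have "ennreal (1 / (2 * \<epsilon>) powr p) * (\<integral>\<^sup>+x. ennreal (?o x) \<partial>\<mu>) \<le> ennreal M"
      using M(2)[OF \<epsilon>2 \<epsilon>(2)] mean_osc_energy[OF f p1 \<epsilon>2] by simp
    then have "ennreal ((2 * \<epsilon>) powr p) * (ennreal (1 / (2 * \<epsilon>) powr p) * (\<integral>\<^sup>+x. ennreal (?o x) \<partial>\<mu>))
        \<le> ennreal ((2 * \<epsilon>) powr p) * ennreal M"
      by (rule mult_left_mono) simp
    moreover have "ennreal ((2 * \<epsilon>) powr p) * ennreal (1 / (2 * \<epsilon>) powr p) = 1"
      using \<epsilon>2 by (simp flip: ennreal_mult)
    ultimately have o_le: "(\<integral>\<^sup>+x. ennreal (?o x) \<partial>\<mu>) \<le> ennreal ((2 * \<epsilon>) powr p * M)"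
      using M(1) by (simp add: mult.assoc[symmetric] ennreal_mult)
    have oi: "integrable \<mu> ?o"
      using om o_le mean_osc_nonneg
      by (intro integrableI_nonneg AE_I2) (simp_all add: le_less_trans[OF o_le])
    have "ennreal (LINT x|\<mu>. ?o x) \<le> ennreal ((2 * \<epsilon>) powr p * M)"
      using o_le nn_integral_eq_integral[OF oi] mean_osc_nonneg by simp
    then have oint: "(LINT x|\<mu>. ?o x) \<le> (2 * \<epsilon>) powr p * M"
      using M(1) by (simp add: ennreal_le_iff)
    have G0: "0 \<le> G x" for x using K \<epsilon> by (simp add: G_def)
    have Gp: "G x powr p = (K / \<epsilon>) powr p * ?o x" for x
    proof -
      have "G x powr p = (K / \<epsilon> * ?o x powr (1 / p)) powr p" by (simp add: G_def)
      also have "\<dots> = (K / \<epsilon>) powr p * (?o x powr (1 / p)) powr p"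
        using K \<epsilon> by (intro powr_mult)
      also have "(?o x powr (1 / p)) powr p = ?o x"
        using p mean_osc_nonneg[of p f "2 * \<epsilon>" x] by (simp add: powr_powr)
      finally show ?thesis .
    qed
    have "G \<in> borel_measurable \<mu>" unfolding G_def using om by measurable
    then have GL: "G \<in> Lp p \<mu>"
      using oi G0 by (simp add: Lp_def Gp)
    have Gint: "(LINT x|\<mu>. G x powr p) \<le> M'"
    proof -
      have "(LINT x|\<mu>. G x powr p) \<le> (K / \<epsilon>) powr p * ((2 * \<epsilon>) powr p * M)"
        using oint by (simp add: Gp mult_left_mono)
      also have "\<dots> = M'" using K \<epsilon> by (simp add: M'_def powr_mult powr_divide)
      finally show ?thesis .
    qed
    note mb = mollify_bounds[OF f p \<epsilon>(1) k_def K_def]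
    have lip: "\<bar>h z - h x\<bar> \<le> G x * dist x z" if "dist x z < \<epsilon>" for x z
      using mb(1)[OF that] by (simp add: h_def G_def)
    have err: "\<bar>h x - f x\<bar> \<le> \<epsilon> * G x" for x
      using mb(2)[of x] \<epsilon> by (simp add: h_def G_def)
    \<comment> \<open>The local slope bound gives continuity, and with it the measurability of
      \<open>h\<close>.\<close>
    have "continuous_on UNIV h"
      unfolding continuous_on_def
    proof
      fix x
      have "((\<lambda>z. h z - h x) \<longlongrightarrow> 0) (at x)"
      proof (rule Lim_null_comparison)
        show "\<forall>\<^sub>F z in at x. norm (h z - h x) \<le> G x * dist x z"
          unfolding eventually_at using \<epsilon>(1)
          by (intro exI[of _ \<epsilon>] conjI ballI impI) (simp_all add: dist_commute[of _ x] lip)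
        have "((\<lambda>z. G x * dist x z) \<longlongrightarrow> G x * dist x x) (at x)"
          by (intro tendsto_intros)
        then show "((\<lambda>z. G x * dist x z) \<longlongrightarrow> 0) (at x)" by simp
      qed
      then show "(h \<longlongrightarrow> h x) (at x)" by (rule LIM_zero_cancel)
    qed
    then have hm: "h \<in> borel_measurable \<mu>"
      using borel_measurable_continuous_onI by (simp add: measurable_cong_sets[OF sets_eq refl])
    have \<epsilon>G: "(\<lambda>x. \<epsilon> * G x) \<in> Lp p \<mu>" using GL by (rule Lp_cmult)
    have hL: "h \<in> Lp p \<mu>"
    proof (rule Lp_dominated[OF hm])
      show "(\<lambda>x. \<bar>f x\<bar> + \<epsilon> * G x) \<in> Lp p \<mu>"
        using p by (intro Lp_add Lp_abs f \<epsilon>G) simp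
      show "\<bar>h x\<bar> \<le> \<bar>f x\<bar> + \<epsilon> * G x" for x using err[of x] by linarith
    qed (use p in simp)
    have "(LINT x|\<mu>. \<bar>h x - f x\<bar> powr p) \<le> (LINT x|\<mu>. \<epsilon> powr p * G x powr p)"
    proof (rule integral_mono)
      show "integrable \<mu> (\<lambda>x. \<bar>h x - f x\<bar> powr p)"
        using LpD(2)[OF Lp_diff[OF hL f]] p by simp
      show "integrable \<mu> (\<lambda>x. \<epsilon> powr p * G x powr p)"
        using LpD(2)[OF GL] G0 by simp
      show "\<bar>h x - f x\<bar> powr p \<le> \<epsilon> powr p * G x powr p" for x
        using powr_mono2[of p "\<bar>h x - f x\<bar>" "\<epsilon> * G x"] err[of x] p \<epsilon> G0[of x]
        by (simp add: powr_mult)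
    qed
    also have "\<dots> \<le> \<epsilon> powr p * M'"
      using Gint by (simp add: mult_left_mono)
    also have "\<dots> \<le> ((\<delta> / (M' + 1)) powr (1 / p)) powr p * M'"
      using \<epsilon> M' p by (intro mult_right_mono powr_mono2) (simp_all add: \<epsilon>_def)
    also have "\<dots> = \<delta> / (M' + 1) * M'"
      using p \<delta> M' by (simp add: powr_powr)
    also have "\<dots> \<le> \<delta>" using \<delta> M' by (simp add: field_simps)
    finally have "gradient_pair p \<mu> f \<delta> \<epsilon> h G"
      using hL GL G0 \<epsilon>(1) lip by (simp add: gradient_pair_def)
    then show ?thesis using Gint by blast
  qed
  then show ?thesis by (rule that)
qed

end

subsection \<open>Near minimisers and absolute continuity\<close>

text \<open>The infimum \<open>a n\<close> of the cost grows with \<open>n\<close>, as the closeness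
  constraint tightens, and it is bounded by \<open>M\<close>. For \<open>N \<le> n\<close> both near
  minimal costs thus lie close to the limit of \<open>a\<close> once \<open>N\<close> is large,
  while their midpoint cannot cost less than \<open>a N\<close>.\<close>

lemma near_minimizers:
  assumes p: "1 < p" and f: "f \<in> Lp p \<mu>"
    and ex: "\<And>\<delta>. 0 < \<delta> \<Longrightarrow> \<exists>\<rho> h G. gradient_pair p \<mu> f \<delta> \<rho> h G \<and> (LINT x|\<mu>. G x powr p) \<le> M"
  obtains \<rho> h G where
    "\<And>n :: nat. gradient_pair p \<mu> f (1 / Suc n) (\<rho> n) (h n) (G n)"
    "\<And>e. 0 < e \<Longrightarrow> \<exists>N. \<forall>n\<ge>N. (LINT x|\<mu>. powr_defect p (G n x) (G N x)) \<le> e"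
proof -
  define S where "S \<delta> = {(LINT x|\<mu>. G x powr p) | \<rho> h G. gradient_pair p \<mu> f \<delta> \<rho> h G}" for \<delta>
  define a where "a n = Inf (S (1 / Suc n))" for n :: nat
  have bdd: "bdd_below (S \<delta>)" for \<delta>
    by (rule bdd_belowI[of _ 0]) (auto simp: S_def intro!: integral_nonneg_AE)
  have ne: "S (1 / Suc n) \<noteq> {}" for n :: nat
    using ex[of "1 / Suc n"] by (auto simp: S_def)
  have a_le: "a n \<le> (LINT x|\<mu>. G x powr p)" if "gradient_pair p \<mu> f (1 / Suc n) \<rho> h G" for n \<rho> h G
    unfolding a_def using bdd that by (intro cInf_lower) (auto simp: S_def)
  have a_M: "a n \<le> M" for n
    using ex[of "1 / Suc n"] a_le[of n] by force
  have mono: "incseq a"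
  proof (rule incseq_SucI)
    fix n
    have "S (1 / Suc (Suc n)) \<subseteq> S (1 / Suc n)"
      unfolding S_def using gradient_pair_mono[of p \<mu> f "1 / Suc (Suc n)" _ _ _ "1 / Suc n"]
      by (force simp: frac_le)
    then show "a n \<le> a (Suc n)"
      unfolding a_def by (intro cInf_superset_mono ne bdd)
  qed
  obtain L where L: "a \<longlonglongrightarrow> L" "\<And>n. a n \<le> L"
    using incseq_convergent[OF mono, of M] a_M by blast
  have "\<exists>\<rho> h G. gradient_pair p \<mu> f (1 / Suc n) \<rho> h G \<and> (LINT x|\<mu>. G x powr p) < a n + 1 / Suc n"
    for n :: nat
  proof -
    have "Inf (S (1 / Suc n)) < a n + 1 / Suc n" by (simp add: a_def)
    then obtain v where "v \<in> S (1 / Suc n)" "v < a n + 1 / Suc n"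
      using cInf_lessD[OF ne] by blast
    then show ?thesis by (auto simp: S_def)
  qed
  then obtain \<rho> h G where gp: "\<And>n :: nat. gradient_pair p \<mu> f (1 / Suc n) (\<rho> n) (h n) (G n)"
    and lt: "\<And>n. (LINT x|\<mu>. G n x powr p) < a n + 1 / Suc n"
    by metis
  have defect: "(LINT x|\<mu>. powr_defect p (G n x) (G N x)) \<le> (L - a N) / 2 + 1 / Suc N"
    if "N \<le> n" for n N
  proof -
    have arith: "(x + y) / 2 - m \<le> ((c + u) + (b + u)) / 2 - b"
      if "x < a + v" "y < b + u" "v \<le> u" "a \<le> c" "b \<le> m" for x y m a b c u v :: real
    proof -
      have "x + y \<le> (c + u) + (b + u)" using that by linarith
      then have "(x + y) / 2 \<le> ((c + u) + (b + u)) / 2" by (rule divide_right_mono) simp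
      then show ?thesis using \<open>b \<le> m\<close> by (rule diff_mono)
    qed
    have eq: "((c + u) + (b + u)) / 2 - b = (c - b) / 2 + u" for b c u :: real
      by (simp add: field_simps)
    have inv: "1 / real (Suc n) \<le> 1 / real (Suc N)" using that by (simp add: frac_le)
    \<comment> \<open>Both pairs satisfy the weaker constraint of index \<open>N\<close>, so their
      midpoint competes in the infimum \<open>a N\<close>.\<close>
    have mid: "gradient_pair p \<mu> f (1 / Suc N) (min (\<rho> n) (\<rho> N)) (\<lambda>x. (h n x + h N x) / 2)
        (\<lambda>x. (G n x + G N x) / 2)"
      using p by (intro gradient_pair_midpoint f gp gradient_pair_mono[OF gp inv]) simp
    have i: "integrable \<mu> (\<lambda>x. G n x powr p)" "integrable \<mu> (\<lambda>x. G N x powr p)"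
      using gradient_pairD(7)[OF gp] by blast+
    have "(LINT x|\<mu>. powr_defect p (G n x) (G N x))
        = ((LINT x|\<mu>. G n x powr p) + (LINT x|\<mu>. G N x powr p)) / 2
          - (LINT x|\<mu>. ((G n x + G N x) / 2) powr p)"
      unfolding powr_defect_def using i gradient_pairD(7)[OF mid] by simp
    also have "\<dots> \<le> ((L + 1 / Suc N) + (a N + 1 / Suc N)) / 2 - a N"
      using lt[of n] lt[of N] inv L(2)[of n] a_le[OF mid] by (rule arith)
    also have "\<dots> = (L - a N) / 2 + 1 / Suc N"
      by (rule eq)
    finally show ?thesis .
  qed
  have lim: "(\<lambda>N. (L - a N) / 2 + 1 / Suc N) \<longlonglongrightarrow> (L - L) / 2 + 0"
    by (intro tendsto_intros L(1)) (use LIMSEQ_inverse_real_of_nat in \<open>simp_all add: inverse_eq_divide\<close>)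
  have "\<exists>N. \<forall>n\<ge>N. (LINT x|\<mu>. powr_defect p (G n x) (G N x)) \<le> e" if "0 < e" for e
  proof -
    have "\<forall>\<^sub>F N in sequentially. (L - a N) / 2 + 1 / Suc N < e"
      using order_tendstoD(2)[OF lim] that by simp
    then obtain N where "(L - a N) / 2 + 1 / Suc N < e"
      by (auto simp: eventually_sequentially)
    then show ?thesis using defect by (meson less_imp_le order_trans)
  qed
  with gp that show ?thesis by blast
qed

section \<open>Diagonal choice of indices and small open neighbourhoods of null sets\<close>

lemma diagonal_sequence:
  fixes P :: "nat \<Rightarrow> nat \<Rightarrow> bool"
  assumes "\<And>j. \<forall>\<^sub>F n in sequentially. P j n"
  obtains k :: "nat \<Rightarrow> nat"
    where "filterlim k at_top sequentially" "\<forall>\<^sub>F n in sequentially. P (k n) n"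
proof -
  \<comment> \<open>The largest admissible index up to \<open>n\<close> is chosen. The index 0 is
    always allowed, so that the maximum exists; this is harmless because \<open>P 0 n\<close> holds
    eventually.\<close>
  define A where "A n = {j. j \<le> n \<and> (j = 0 \<or> P j n)}" for n
  define k where "k n = Max (A n)" for n
  have fin: "finite (A n)" for n by (simp add: A_def)
  have kA: "k n \<in> A n" for n
    unfolding k_def using fin by (rule Max_in) (auto simp: A_def)
  have "filterlim k at_top sequentially"
    unfolding filterlim_at_top
  proof
    fix j
    show "\<forall>\<^sub>F n in sequentially. j \<le> k n"
      using assms[of j] eventually_ge_at_top[of j]
    proof eventually_elim
      case (elim n)
      then show ?case unfolding k_def by (intro Max_ge fin) (simp add: A_def)
    qed
  qed
  moreover have "\<forall>\<^sub>F n in sequentially. P (k n) n"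
    using assms[of 0]
  proof eventually_elim
    case (elim n)
    then show ?case using kA[of n] by (cases "k n = 0") (simp_all add: A_def)
  qed
  ultimately show ?thesis by (rule that)
qed

lemma null_set_open_superset_integral_less:
  fixes g :: "'a::metric_space \<Rightarrow> real"
  assumes \<mu>: "radon_measure \<mu>" and A: "A \<in> null_sets \<mu>" and g: "integrable \<mu> g" and e: "0 < e"
  obtains U where "open U" "A \<subseteq> U" "(LINT x:U|\<mu>. g x) < e"
proof -
  have sets: "sets \<mu> = sets borel" using \<mu> by (simp add: radon_measure_def)
  have "A \<in> sets borel" using A sets by blast
  then have 0: "(INF U\<in>{U. open U \<and> A \<subseteq> U}. emeasure \<mu> U) = 0"
    using \<mu> A unfolding radon_measure_def by (metis null_setsD1)
  have "\<exists>U. open U \<and> A \<subseteq> U \<and> emeasure \<mu> U < ennreal (1 / Suc n)" for n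
  proof -
    have "(INF U\<in>{U. open U \<and> A \<subseteq> U}. emeasure \<mu> U) < ennreal (1 / Suc n)"
      unfolding 0 by simp
    then show ?thesis unfolding INF_less_iff by blast
  qed
  then obtain U where U: "\<And>n. open (U n)" "\<And>n. A \<subseteq> U n"
    "\<And>n. emeasure \<mu> (U n) < ennreal (1 / Suc n)"
    by metis
  \<comment> \<open>Finite intersections stay open and contain \<open>A\<close>, and they form a
    decreasing sequence with null intersection, so the integrals over them tend to 0.\<close>
  define V where "V n = (\<Inter>i\<le>n. U i)" for n
  have V: "open (V n)" "A \<subseteq> V n" "V n \<subseteq> U n" for n
    using U by (auto simp: V_def intro!: open_INT)
  have Vs: "V n \<in> sets \<mu>" for n unfolding sets using V(1) by (rule borel_open)
  have "decseq V" by (auto simp: V_def decseq_def)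
  moreover have "set_integrable \<mu> (V 0) g"
    unfolding set_integrable_def using g Vs by (intro integrable_mult_indicator)
  ultimately have lim: "(\<lambda>n. LINT x:V n|\<mu>. g x) \<longlonglongrightarrow> (LINT x:(\<Inter>n. V n)|\<mu>. g x)"
    using Vs by (intro set_integral_cont_down)
  have "emeasure \<mu> (\<Inter>n. V n) \<le> 0"
  proof (rule LIMSEQ_le_const)
    show "(\<lambda>n. ennreal (1 / Suc n)) \<longlonglongrightarrow> 0"
      using tendsto_ennrealI[OF LIMSEQ_inverse_real_of_nat] by (simp add: inverse_eq_divide)
    have "emeasure \<mu> (\<Inter>n. V n) \<le> ennreal (1 / Suc n)" for n
    proof -
      have "U n \<in> sets \<mu>" unfolding sets using U(1) by (rule borel_open)
      then have "emeasure \<mu> (\<Inter>n. V n) \<le> emeasure \<mu> (U n)"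
        using V(3)[of n] by (intro emeasure_mono) blast+
      then show ?thesis using U(3)[of n] by order
    qed
    then show "\<exists>N. \<forall>n\<ge>N. emeasure \<mu> (\<Inter>n. V n) \<le> ennreal (1 / Suc n)" by blast
  qed
  then have "(\<Inter>n. V n) \<in> null_sets \<mu>"
    using Vs by (intro null_setsI sets.countable_INT) auto
  then have "AE x in \<mu>. x \<notin> (\<Inter>n. V n)" by (rule AE_not_in)
  then have "AE x in \<mu>. indicator (\<Inter>n. V n) x *\<^sub>R g x = 0" by eventually_elim simp
  then have "(LINT x:(\<Inter>n. V n)|\<mu>. g x) = 0"
    unfolding set_lebesgue_integral_def by (rule integral_eq_zero_AE)
  with lim e obtain n where "(LINT x:V n|\<mu>. g x) < e"
    using order_tendstoD(2)[of _ 0 sequentially e] by (auto simp: eventually_sequentially)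
  with V that show ?thesis by blast
qed

text \<open>Positivity at radius \<open>s\<close> is read off at twice the radius
  \<open>s / 2\<close>; finiteness follows by cancelling the positive constant.\<close>

lemma doubling_if_cheeger_space:
  assumes "cheeger_space p \<mu>"
  obtains C where "doubling \<mu> C"
proof -
  have \<mu>: "radon_measure \<mu>" "volume_doubling \<mu>"
    using assms by (auto simp: cheeger_space_def)
  then obtain C where C: "0 < C" "\<And>x s. 0 < s \<Longrightarrow> 0 < emeasure \<mu> (ball x (2 * s))"
    "\<And>x s. 0 < s \<Longrightarrow> emeasure \<mu> (ball x (2 * s)) \<le> ennreal C * emeasure \<mu> (ball x s)"
    "\<And>x s. 0 < s \<Longrightarrow> ennreal C * emeasure \<mu> (ball x s) < \<infinity>"
    unfolding volume_doubling_def by blast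
  have fin: "emeasure \<mu> (ball x s) < \<infinity>" if "0 < s" for x s
    using C(4)[OF that, of x] C(1) by (auto simp: ennreal_mult_less_top)
  have eq: "emeasure \<mu> (ball x s) = ennreal (measure \<mu> (ball x s))" if "0 < s" for x s
    using fin[OF that, of x] by (intro emeasure_eq_ennreal_measure) simp
  have "doubling \<mu> C"
  proof
    show "sets \<mu> = sets borel" using \<mu>(1) by (simp add: radon_measure_def)
    show "0 < measure \<mu> (ball x s)" if "0 < s" for x s
      using C(2)[of "s / 2" x] that eq[of s x] by (simp add: ennreal_less_zero_iff)
    show "measure \<mu> (ball x (2 * s)) \<le> C * measure \<mu> (ball x s)" if "0 < s" for x s
      using C(3)[OF that, of x] C(1) that eq[OF that, of x] eq[of "2 * s" x]
      by (simp flip: ennreal_mult)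
  qed (use C fin in blast)+
  then show ?thesis by (rule that)
qed

theorem theorem4p16:
  fixes p :: real
    and \<mu> :: "'a::complete_space measure"
    and r :: "nat \<Rightarrow> real"
    and \<Gamma> :: "('a \<Rightarrow> real) \<Rightarrow> 'a set \<Rightarrow> ereal"
    and f :: "'a \<Rightarrow> real"
    and \<nu> :: "'a measure"
  assumes "1 < p"
    and "cheeger_space p \<mu>"
    and "\<And>n. 0 < r n" and "r \<longlonglongrightarrow> 0"
    and "\<exists>E. Gamma_converges p \<mu> (\<lambda>n g. enn2ereal (energy p \<mu> (r n) g UNIV)) E"
    and "Gamma_bar_converges p \<mu> (\<lambda>n g U. enn2ereal (energy p \<mu> (r n) g U)) \<Gamma>"
    and "f \<in> KS p \<mu>"
    and "is_energy_measure \<Gamma> f \<nu>"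
  shows "absolutely_continuous \<mu> \<nu>"
proof -
  have p: "1 < p" "1 \<le> p" using assms(1) by simp_all
  obtain C where "doubling \<mu> C" using doubling_if_cheeger_space[OF assms(2)] .
  then interpret doubling \<mu> C .
  have radon: "radon_measure \<mu>" using assms(2) by (simp add: cheeger_space_def)
  define L where "L = Limsup (at_right 0) (\<lambda>s. energy p \<mu> s f UNIV)"
  have f: "f \<in> Lp p \<mu>" and L: "L < \<infinity>"
    using assms(7) by (auto simp: KS_def L_def)
  \<comment> \<open>Exceeding the upper limit strictly makes \<open>M\<close> a bound for the energy
    at all sufficiently small scales.\<close>
  define M where "M = enn2real L + 1"
  have "L = ennreal (enn2real L)" using L by simp
  also have "\<dots> < ennreal M" unfolding M_def by (rule ennreal_lessI) (simp_all add: add_nonneg_pos)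
  finally have M: "Limsup (at_right 0) (\<lambda>s. energy p \<mu> s f UNIV) < ennreal M" "0 \<le> M"
    by (simp_all add: L_def M_def)
  from Limsup_lessD[OF M(1)]
  obtain s0 where s0: "0 < s0" "\<And>s. 0 < s \<Longrightarrow> s < s0 \<Longrightarrow> energy p \<mu> s f UNIV \<le> ennreal M"
    by (auto simp: eventually_at_right_field dest: less_imp_le)
  obtain M' where M': "\<And>\<delta>. 0 < \<delta> \<Longrightarrow>
      \<exists>\<rho> h G. gradient_pair p \<mu> f \<delta> \<rho> h G \<and> (LINT x|\<mu>. G x powr p) \<le> M'"
    using gradient_pair_exists[OF p(1) f s0(1) M(2) s0(2)] by blast
  obtain \<rho> h G where gp: "\<And>n :: nat. gradient_pair p \<mu> f (1 / Suc n) (\<rho> n) (h n) (G n)"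
    and defect: "\<And>e. 0 < e \<Longrightarrow> \<exists>N. \<forall>n\<ge>N. (LINT x|\<mu>. powr_defect p (G n x) (G N x)) \<le> e"
    using near_minimizers[OF p(1) f M'] by blast
  note g = gradient_pairD[OF gp]
  obtain K where K: "0 < K"
    "\<And>a b. 0 \<le> a \<Longrightarrow> 0 \<le> b \<Longrightarrow> a powr p \<le> K * (b powr p + powr_defect p a b)"
    using powr_le_defect[OF p(1)] by blast
  \<comment> \<open>Each pair controls the energy only below its own scale, so the index
    \<open>k n\<close> must grow slowly enough that \<open>r n\<close> stays below
    \<open>\<rho> (k n)\<close>.\<close>
  have "\<forall>\<^sub>F n in sequentially. r n < \<rho> j" for j
    using order_tendstoD(2)[OF assms(4)] g(4) by blast
  then obtain k where k: "filterlim k at_top sequentially" "\<forall>\<^sub>F n in sequentially. r n < \<rho> (k n)"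
    using diagonal_sequence[of "\<lambda>j n. r n < \<rho> j"] by blast
  have conv: "Lp_converges p \<mu> (\<lambda>n. h (k n)) f"
    unfolding Lp_converges_def
  proof (intro conjI allI g(1) f)
    have "(\<lambda>j. (1 / real (Suc j)) powr (1 / p)) \<longlonglongrightarrow> 0 powr (1 / p)"
      using p LIMSEQ_inverse_real_of_nat
      by (intro tendsto_powr2 tendsto_const) (simp_all add: inverse_eq_divide)
    then have "(\<lambda>n. (1 / real (Suc (k n))) powr (1 / p)) \<longlonglongrightarrow> 0"
      using filterlim_compose[OF _ k(1)] by fastforce
    then show "(\<lambda>n. Lp_norm p \<mu> (\<lambda>x. h (k n) x - f x)) \<longlonglongrightarrow> 0"
    proof (rule Lim_null_comparison[rotated])
      have "Lp_norm p \<mu> (\<lambda>x. h j x - f x) \<le> (1 / real (Suc j)) powr (1 / p)" for j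
        unfolding Lp_norm_def using p g(6)[of j]
        by (intro powr_mono2 integral_nonneg_AE) simp_all
      then show "\<forall>\<^sub>F n in sequentially. norm (Lp_norm p \<mu> (\<lambda>x. h (k n) x - f x))
          \<le> (1 / real (Suc (k n))) powr (1 / p)"
        by (simp add: Lp_norm_def)
    qed
  qed
  have \<nu>: "radon_measure \<nu>" "\<And>U. open U \<Longrightarrow> enn2ereal (emeasure \<nu> U) = \<Gamma> f U"
    using assms(8) by (auto simp: is_energy_measure_def)
  then have sets\<nu>: "sets \<nu> = sets borel" by (simp add: radon_measure_def)
  have small: "emeasure \<nu> A \<le> ennreal e" if A: "A \<in> null_sets \<mu>" and e: "0 < e" for A e
  proof -
    \<comment> \<open>The index \<open>N\<close> is fixed first, and \<open>U\<close> is then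
      adapted to the single function \<open>G N\<close>. The tolerance \<open>e / (2 * K)\<close> is
      spent twice: on the defect and on the integral of \<open>G N x powr p\<close> over
      \<open>U\<close>.\<close>
    obtain N where N: "\<And>n. N \<le> n \<Longrightarrow> (LINT x|\<mu>. powr_defect p (G n x) (G N x)) \<le> e / (2 * K)"
      using defect[of "e / (2 * K)"] e K(1) by auto
    obtain U where U: "open U" "A \<subseteq> U" "(LINT x:U|\<mu>. G N x powr p) < e / (2 * K)"
      using null_set_open_superset_integral_less[OF radon A g(7)[of N], of "e / (2 * K)"] e K(1) by auto
    have Us: "U \<in> sets \<mu>" using U(1) by simp
    have le: "(LINT x:U|\<mu>. G n x powr p) \<le> e" if n: "N \<le> n" for n
    proof -
      have si: "set_integrable \<mu> U (\<lambda>x. G j x powr p)" for j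
        using g(7)[of j] Us unfolding set_integrable_def by (intro integrable_mult_indicator)
      have mid: "integrable \<mu> (\<lambda>x. ((G n x + G N x) / 2) powr p)"
        using gradient_pairD(7)[OF gradient_pair_midpoint[OF p(2) f gradient_pair_mono[OF gp[of n], of 1]
          gradient_pair_mono[OF gp[of N], of 1]]] by simp
      have D: "integrable \<mu> (\<lambda>x. powr_defect p (G n x) (G N x))"
        unfolding powr_defect_def using g(7) mid by simp
      have D0: "0 \<le> powr_defect p (G n x) (G N x)" for x
        using powr_midpoint_le[OF g(3)[of n x] g(3)[of N x] p(2)] by (simp add: powr_defect_def)
      have sD: "set_integrable \<mu> U (\<lambda>x. powr_defect p (G n x) (G N x))"
        using D Us unfolding set_integrable_def by (intro integrable_mult_indicator)
      \<comment> \<open>Comparison with the fixed \<open>G N\<close> makes the estimate uniform over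
        all \<open>n \<ge> N\<close>, although \<open>U\<close> was chosen for \<open>G N\<close>
        alone.\<close>
      have "(LINT x:U|\<mu>. G n x powr p)
          \<le> (LINT x:U|\<mu>. K * (G N x powr p + powr_defect p (G n x) (G N x)))"
        using K(2)[OF g(3) g(3)] by (intro set_integral_mono si set_integrable_mult_right set_integral_add sD)
      also have "\<dots> = K * ((LINT x:U|\<mu>. G N x powr p) + (LINT x:U|\<mu>. powr_defect p (G n x) (G N x)))"
        using si sD by simp
      also have "(LINT x:U|\<mu>. powr_defect p (G n x) (G N x)) \<le> (LINT x|\<mu>. powr_defect p (G n x) (G N x))"
        unfolding set_lebesgue_integral_def
        using D D0 sD[unfolded set_integrable_def]
        by (intro integral_mono) (simp_all add: indicator_def)
      also have "(LINT x|\<mu>. powr_defect p (G n x) (G N x)) \<le> e / (2 * K)" by (rule N[OF n])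
      also have "(LINT x:U|\<mu>. G N x powr p) \<le> e / (2 * K)" using U(3) by simp
      also have "K * (e / (2 * K) + e / (2 * K)) = e" using K(1) by simp
      finally show ?thesis using K(1) by simp
    qed
    have "\<forall>\<^sub>F n in sequentially. N \<le> k n"
      using k(1) by (simp add: filterlim_at_top)
    with k(2) have "\<forall>\<^sub>F n in sequentially. enn2ereal (energy p \<mu> (r n) (h (k n)) U) \<le> ereal e"
    proof eventually_elim
      case (elim n)
      have "energy p \<mu> (r n) (h (k n)) U \<le> ennreal (LINT x:U|\<mu>. G (k n) x powr p)"
        using elim(1) U(1) by (intro energy_gradient_pair_le[OF gp p(2) assms(3)]) simp_all
      also have "\<dots> \<le> ennreal e" using le[OF elim(2)] by (rule ennreal_leI)
      finally show ?case
        using e by (simp add: less_eq_ennreal.rep_eq)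
    qed
    then have "liminf (\<lambda>n. enn2ereal (energy p \<mu> (r n) (h (k n)) U)) \<le> ereal e"
      by (intro order_trans[OF Liminf_le_Limsup Limsup_bounded]) simp_all
    \<comment> \<open>The lower bound of the convergence is applied on \<open>U\<close> itself along
      the diagonal sequence, whose energies on \<open>U\<close> are eventually at most
      \<open>e\<close>.\<close>
    moreover have "\<Gamma> f U \<le> liminf (\<lambda>n. enn2ereal (energy p \<mu> (r n) (h (k n)) U))"
      using assms(6) conv U(1) unfolding Gamma_bar_converges_def by blast
    ultimately have "enn2ereal (emeasure \<nu> U) \<le> ereal e"
      using \<nu>(2)[OF U(1)] by simp
    then have "emeasure \<nu> U \<le> ennreal e"
      using e by (simp add: less_eq_ennreal.rep_eq)
    moreover have "emeasure \<nu> A \<le> emeasure \<nu> U"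
      using U sets\<nu> by (intro emeasure_mono) simp_all
    ultimately show ?thesis by order
  qed
  show ?thesis
    unfolding absolutely_continuous_def
  proof
    fix A assume A: "A \<in> null_sets \<mu>"
    have "emeasure \<nu> A \<le> 0 + ennreal e" if "0 < e" for e
      using small[OF A that] by simp
    then have "emeasure \<nu> A \<le> 0" by (rule ennreal_le_epsilon)
    then show "A \<in> null_sets \<nu>"
      using A null_setsD2[OF A] sets\<nu> sets_eq by (intro null_setsI) simp_all
  qed
qed

end
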